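(* Let $W$ be a finite Coxeter group of rank $n$ with base (set of fundamental roots) $\Pi$. Then, as an identity of polynomials in $t$, $$\sum_{K \subseteq \Pi} (-1)^{n-|K|}\, \frac{|W|}{|W_K|}\, \frac{\chi(L^{\mathrm{Fix}(W_K)},t)}{\chi(L^{\mathrm{Fix}(W_K)},-1)} = t^n.$$
   Context: $W$ is a finite Coxeter group of rank $n$ acting as a reflection group on a real Euclidean space $V$ of dimension $n$ (its standard reflection representation), with $W$-invariant root system and a base $\Pi$ of fundamental (simple) roots, $|\Pi|=n$. For $K \subseteq \Pi$, $W_K$ denotes the standard parabolic subgroup of $W$ generated by the reflections in the roots of $K$ (with $W_\emptyset$ trivial), and $\mathrm{Fix}(W_K)=\{v \in V : w(v)=v \text{ for all } w \in W_K\}$. Let $\mathcal{A}$ be the set of root hyperplanes of $W$ in $V$ (the hyperplanes orthogonal to the roots), and let $L$ be the set of all intersections of hyperplanes in $\mathcal{A}$, including $V$ itself (the empty intersection). Partially order $L$ by reverse inclusion, so $X \leq Y$ iff $X \supseteq Y$. The Moebius function $\mu$ of $L$ is defined by $\mu(X,X)=1$, $\sum_{X \leq Z \leq Y} \mu(Z,Y)=0$ if $X<Y$, and $\mu(X,Y)=0$ otherwise. The characteristic polynomial of $L$ is $\chi(L,t)=\sum_{X \in L}\mu(V,X)\,t^{\dim X}$. For $X \in L$, $L^X$ denotes the segment $\{Y \in L : Y \geq X\}$, with minimal element $X$, and its characteristic polynomial is $\chi(L^X,t)=\sum_{Y \in L,\, Y \geq X}\mu(X,Y)\,t^{\dim Y}$.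 *)

theory Defs
  imports
    "HOL-Analysis.Analysis"
    "HOL-Computational_Algebra.Polynomial"
    "HOL-Algebra.Bij"
    "HOL-Algebra.Generated_Groups"
begin

(* The ambient space is the whole of a type of class real_inner; it is finite-dimensional because
   a finite root system spans it. Class euclidean_space would exclude dimension 0, that is, the
   trivial group of rank 0 with an empty base. *)

definition reflection :: "'a::real_inner \<Rightarrow> 'a \<Rightarrow> 'a" where
  "reflection \<alpha> v = v - (2 * (v \<bullet> \<alpha>) / (\<alpha> \<bullet> \<alpha>)) *\<^sub>R \<alpha>"

definition root_system :: "'a::real_inner set \<Rightarrow> bool" where
  "root_system \<Phi> \<longleftrightarrow>
     finite \<Phi> \<and> 0 \<notin> \<Phi> \<and> span \<Phi> = UNIV \<and>
     (\<forall>\<alpha>\<in>\<Phi>. reflection \<alpha> ` \<Phi> = \<Phi>) \<and>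
     (\<forall>\<alpha>\<in>\<Phi>. \<Phi> \<inter> span {\<alpha>} = {\<alpha>, - \<alpha>})"

definition root_base :: "'a::real_inner set \<Rightarrow> 'a set \<Rightarrow> bool" where
  "root_base \<Phi> \<Delta> \<longleftrightarrow>
     \<Delta> \<subseteq> \<Phi> \<and> independent \<Delta> \<and>
     (\<forall>\<alpha>\<in>\<Phi>. \<exists>c. (\<forall>\<beta>\<in>\<Delta>. 0 \<le> c \<beta>) \<and>
        (\<alpha> = (\<Sum>\<beta>\<in>\<Delta>. c \<beta> *\<^sub>R \<beta>) \<or> \<alpha> = - (\<Sum>\<beta>\<in>\<Delta>. c \<beta> *\<^sub>R \<beta>)))"

(* For a root system \<Phi> with base \<Delta>, W is reflection_group \<Phi> and W_K is reflection_group K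
   for K \<subseteq> \<Delta>. *)
definition reflection_group :: "'a::real_inner set \<Rightarrow> ('a \<Rightarrow> 'a) set" where
  "reflection_group K = generate (BijGroup UNIV) (reflection ` K)"

definition Fix :: "('a \<Rightarrow> 'a) set \<Rightarrow> 'a set" where
  "Fix G = {v. \<forall>w\<in>G. w v = v}"

definition root_hyperplanes :: "'a::real_inner set \<Rightarrow> 'a set set" where
  "root_hyperplanes \<Phi> = (\<lambda>\<alpha>. {v. \<alpha> \<bullet> v = 0}) ` \<Phi>"

(* The empty intersection is UNIV, the whole space. *)
definition intersection_lattice :: "'a::real_inner set \<Rightarrow> 'a set set" where
  "intersection_lattice \<Phi> = {\<Inter>\<B> | \<B>. \<B> \<subseteq> root_hyperplanes \<Phi>}"

lemma finite_intersection_lattice: "finite \<Phi> \<Longrightarrow> finite (intersection_lattice \<Phi>)"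
proof -
  assume "finite \<Phi>"
  moreover have "intersection_lattice \<Phi> = Inter ` Pow (root_hyperplanes \<Phi>)"
    by (auto simp: intersection_lattice_def)
  ultimately show ?thesis by (simp add: root_hyperplanes_def)
qed

(* Moebius function of a finite family L of sets under reverse inclusion: X precedes Y iff Y \<subseteq> X.
   The recursion is over the first argument; for an infinite L the value is a dummy. *)
function mobius :: "'a set set \<Rightarrow> 'a set \<Rightarrow> 'a set \<Rightarrow> int" where
  "mobius L X Y =
     (if finite L \<and> X \<in> L \<and> Y \<in> L \<and> Y \<subseteq> X
      then if X = Y then 1 else - (\<Sum>Z\<in>{Z \<in> L. Y \<subseteq> Z \<and> Z \<subset> X}. mobius L Z Y)
      else 0)"
  by pat_completeness auto
termination
proof (relation "Wellfounded.measure (\<lambda>(L, X, Y). card {U \<in> L. U \<subset> X})")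
  fix L :: "'a set set" and X Y Z
  assume *: "finite L \<and> X \<in> L \<and> Y \<in> L \<and> Y \<subseteq> X" "Z \<in> {Z \<in> L. Y \<subseteq> Z \<and> Z \<subset> X}"
  have "{U \<in> L. U \<subset> Z} \<subset> {U \<in> L. U \<subset> X}"
    using * by blast
  with * show "((L, Z, Y), (L, X, Y)) \<in> Wellfounded.measure (\<lambda>(L, X, Y). card {U \<in> L. U \<subset> X})"
    by (simp add: psubset_card_mono)
qed simp

declare mobius.simps [simp del]

lemma mobius_same: "finite L \<Longrightarrow> X \<in> L \<Longrightarrow> mobius L X X = 1"
  by (subst mobius.simps) simp

lemma mobius_sum:
  assumes "finite L" "X \<in> L" "Y \<in> L" "Y \<subset> X"
  shows "(\<Sum>Z\<in>{Z \<in> L. Y \<subseteq> Z \<and> Z \<subseteq> X}. mobius L Z Y) = 0"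
proof -
  have "{Z \<in> L. Y \<subseteq> Z \<and> Z \<subseteq> X} = insert X {Z \<in> L. Y \<subseteq> Z \<and> Z \<subset> X}"
    using assms by blast
  moreover have "mobius L X Y = - (\<Sum>Z\<in>{Z \<in> L. Y \<subseteq> Z \<and> Z \<subset> X}. mobius L Z Y)"
    using assms by (subst mobius.simps) auto
  ultimately show ?thesis
    using assms(1) by simp
qed

lemma mobius_outside: "\<not> Y \<subseteq> X \<Longrightarrow> mobius L X Y = 0"
  by (subst mobius.simps) simp

definition segment :: "'a set set \<Rightarrow> 'a set \<Rightarrow> 'a set set" where
  "segment L X = {Y \<in> L. Y \<subseteq> X}"

definition segment_char_poly :: "'a::real_vector set set \<Rightarrow> 'a set \<Rightarrow> real poly" where
  "segment_char_poly L X = (\<Sum>Y\<in>segment L X. monom (of_int (mobius L X Y)) (dim Y))"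

end

theory Submission
  imports Defs
begin

text \<open>
  The index of a parabolic subgroup \<open>W\<^sub>K\<close> counts the faces of the Coxeter complex of type \<open>K\<close>, all of
  which have dimension \<open>n - |K|\<close> and span flats conjugate to \<open>Fix W\<^sub>K\<close>. So the sum is a sum over all faces
  of the reflection arrangement; collect its terms by the flat \<open>X\<close> which a face spans. The Euler
  characteristic of the decomposition of a flat into faces is \<open>\<plusminus>1\<close>, so by Moebius inversion the number
  of faces spanning \<open>X\<close> is \<open>\<plusminus>\<chi>(L\<^sup>X, -1)\<close>, which cancels the denominator. What remains is
  the sum of \<open>\<chi>(L\<^sup>X, t)\<close> over all flats \<open>X\<close>, which is \<open>t\<^sup>n\<close> by Moebius inversion again.
\<close>

section \<open>Flats and Moebius inversion\<close>

text \<open>The regrouping is possible because the sign in the theorem is (-1)^dim of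
  \<open>Fix (reflection_group K)\<close>, so that the contribution of a face depends only on the
  flat X it spans: it is the characteristic polynomial of X divided by the number of faces spanning
  X. Two points need work. Counting faces by type needs the stabilizer of a face of the fundamental
  chamber to be exactly the parabolic subgroup; this rests on the exchange condition for words in
  simple reflections, and on the fact that these already generate the group, which is defined by the
  reflections in all roots. The Euler relation avoids topology: faces are sign vectors, and
  hyperplanes are added one at a time inside an arbitrary subspace, so that the result applies to
  every flat.\<close>

lemma sum_segment_mobius:
  fixes g :: "'a set \<Rightarrow> 'b::comm_ring_1"
  assumes L: "finite L" "Z \<in> L"
  shows "(\<Sum>X\<in>segment L Z. \<Sum>Y\<in>segment L X. of_int (mobius L X Y) * g Y) = g Z"
proof -
  have fin: "finite (segment L X)" for X
    using L by (simp add: segment_def)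
  have "(\<Sum>X\<in>segment L Z. \<Sum>Y\<in>segment L X. of_int (mobius L X Y) * g Y)
      = (\<Sum>X\<in>segment L Z. \<Sum>Y\<in>segment L Z. of_int (mobius L X Y) * g Y)"
  proof (rule sum.cong[OF refl])
    fix X assume "X \<in> segment L Z"
    then show "(\<Sum>Y\<in>segment L X. of_int (mobius L X Y) * g Y)
      = (\<Sum>Y\<in>segment L Z. of_int (mobius L X Y) * g Y)"
      using fin by (intro sum.mono_neutral_left) (auto simp: segment_def mobius_outside)
  qed
  also have "\<dots> = (\<Sum>Y\<in>segment L Z. of_int (\<Sum>X\<in>segment L Z. mobius L X Y) * g Y)"
    by (subst sum.swap) (simp add: sum_distrib_right)
  also have "\<dots> = (\<Sum>Y\<in>segment L Z. if Y = Z then g Z else 0)"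
  proof (rule sum.cong[OF refl])
    fix Y assume Y: "Y \<in> segment L Z"
    \<comment> \<open>For fixed \<open>Y\<close> only the interval between \<open>Y\<close> and
      \<open>Z\<close> contributes. The recursion of \<open>mobius\<close> runs over its first
      argument, which is the one summed here.\<close>
    have "(\<Sum>X\<in>segment L Z. mobius L X Y) = (\<Sum>X\<in>{X \<in> L. Y \<subseteq> X \<and> X \<subseteq> Z}. mobius L X Y)"
      using L(1) mobius_outside[of Y _ L] by (intro sum.mono_neutral_right) (auto simp: segment_def)
    also have "\<dots> = (if Y = Z then 1 else 0)"
    proof (cases "Y = Z")
      case True
      then have "{X \<in> L. Y \<subseteq> X \<and> X \<subseteq> Z} = {Z}" using L by auto
      then show ?thesis using True L by (simp add: mobius_same)
    next
      case False
      then show ?thesis using Y L by (auto simp: segment_def intro!: mobius_sum)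
    qed
    finally show "of_int (\<Sum>X\<in>segment L Z. mobius L X Y) * g Y = (if Y = Z then g Z else 0)"
      by simp
  qed
  also have "\<dots> = g Z"
    using fin L by (simp add: segment_def)
  finally show ?thesis .
qed

text \<open>The system is triangular along inclusion: the value at \<open>X\<close> is fixed once
  the values at smaller flats are. It serves to identify signed face counts with values of
  characteristic polynomials from their segment sums alone.\<close>

lemma segment_sums_determine:
  fixes f h :: "'a set \<Rightarrow> 'b::comm_ring_1"
  assumes L: "finite L"
    and eq: "\<And>Z. Z \<in> L \<Longrightarrow> sum f (segment L Z) = sum h (segment L Z)"
  shows "X \<in> L \<Longrightarrow> f X = h X"
proof (induction "card (segment L X)" arbitrary: X rule: less_induct)
  case less
  have fin: "finite (segment L X)" using L by (simp add: segment_def)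
  have X: "X \<in> segment L X" using less.prems by (simp add: segment_def)
  have "f Y = h Y" if Y: "Y \<in> segment L X - {X}" for Y
  proof (rule less.hyps)
    have "segment L Y \<subset> segment L X"
      using Y X by (auto simp: segment_def)
    then show "card (segment L Y) < card (segment L X)"
      using fin by (rule psubset_card_mono[rotated])
    show "Y \<in> L" using Y by (simp add: segment_def)
  qed
  then have "sum f (segment L X - {X}) = sum h (segment L X - {X})"
    by (intro sum.cong) auto
  with eq[OF less.prems] show ?case
    by (simp add: sum.remove[OF fin X])
qed

lemma poly_segment_char_poly:
  "poly (segment_char_poly L X) t = (\<Sum>Y\<in>segment L X. of_int (mobius L X Y) * t ^ dim Y)"
  by (simp add: segment_char_poly_def poly_sum poly_monom)

lemma sum_segment_char_poly:
  assumes "finite L" "Z \<in> L"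
  shows "(\<Sum>X\<in>segment L Z. segment_char_poly L X) = monom 1 (dim Z)"
proof -
  have "of_int (mobius L X Y) * monom (1::real) (dim Y) = monom (of_int (mobius L X Y)) (dim Y)" for X Y
    by (simp add: of_int_poly smult_monom)
  then show ?thesis
    using sum_segment_mobius[OF assms, of "\<lambda>Y. monom (1::real) (dim Y)"]
    by (simp add: segment_char_poly_def)
qed

text \<open>An injection whose images permute \<open>L\<close> is an automorphism of the inclusion
  order, and \<open>mobius\<close> sees nothing else. The premise stays inside the goal because the
  induction varies \<open>L\<close> as well.\<close>

lemma mobius_image:
  assumes g: "inj g"
  shows "(`) g ` L = L \<Longrightarrow> mobius L (g ` X) (g ` Y) = mobius L X Y"
proof (induction L X Y rule: mobius.induct)
  case (1 L X Y)
  have mem: "g ` Z \<in> L \<longleftrightarrow> Z \<in> L" for Z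
  proof
    assume "g ` Z \<in> L"
    then obtain Z' where "Z' \<in> L" "g ` Z = g ` Z'" using 1(2) by (metis imageE)
    then show "Z \<in> L" using inj_image_eq_iff[OF g] by simp
  qed (metis 1(2) imageI)
  show ?case
  proof (cases "finite L \<and> X \<in> L \<and> Y \<in> L \<and> Y \<subseteq> X \<and> X \<noteq> Y")
    case True
    have "{Z \<in> L. g ` Y \<subseteq> Z \<and> Z \<subset> g ` X} = (`) g ` {Z \<in> L. Y \<subseteq> Z \<and> Z \<subset> X}"
    proof (intro subset_antisym subsetI)
      fix U assume U: "U \<in> {Z \<in> L. g ` Y \<subseteq> Z \<and> Z \<subset> g ` X}"
      then obtain Z where "Z \<in> L" "U = g ` Z" using 1(2) by (metis (lifting) imageE mem_Collect_eq)
      then show "U \<in> (`) g ` {Z \<in> L. Y \<subseteq> Z \<and> Z \<subset> X}"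
        using U inj_image_subset_iff[OF g] by (auto simp: psubset_eq)
    next
      fix U assume "U \<in> (`) g ` {Z \<in> L. Y \<subseteq> Z \<and> Z \<subset> X}"
      then show "U \<in> {Z \<in> L. g ` Y \<subseteq> Z \<and> Z \<subset> g ` X}"
        using inj_image_subset_iff[OF g] inj_image_eq_iff[OF g] mem
        by (auto simp: psubset_eq)
    qed
    moreover have "inj_on ((`) g) {Z \<in> L. Y \<subseteq> Z \<and> Z \<subset> X}"
      using inj_image_eq_iff[OF g] by (auto simp: inj_on_def)
    ultimately have "(\<Sum>Z\<in>{Z \<in> L. g ` Y \<subseteq> Z \<and> Z \<subset> g ` X}. mobius L Z (g ` Y))
        = (\<Sum>Z\<in>{Z \<in> L. Y \<subseteq> Z \<and> Z \<subset> X}. mobius L (g ` Z) (g ` Y))"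
      by (simp add: sum.reindex)
    also have "\<dots> = (\<Sum>Z\<in>{Z \<in> L. Y \<subseteq> Z \<and> Z \<subset> X}. mobius L Z Y)"
      using 1 True by (intro sum.cong) auto
    finally show ?thesis
      using True mem inj_image_subset_iff[OF g] inj_image_eq_iff[OF g]
      by (subst (1 2) mobius.simps) simp
  next
    case False
    then show ?thesis
      using mem inj_image_subset_iff[OF g] inj_image_eq_iff[OF g]
      by (subst (1 2) mobius.simps) auto
  qed
qed

section \<open>Sign vectors of hyperplane arrangements\<close>

text \<open>The type class allows infinite dimension; the finite spanning set \<open>B\<close>,
  later the set of roots, is what makes the basis finite.\<close>

lemma finite_basis_exists:
  fixes B S :: "'a::real_vector set"
  assumes "finite B" "span B = UNIV"
  obtains C where "C \<subseteq> S" "finite C" "independent C" "S \<subseteq> span C" "card C = dim S"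
proof -
  obtain C where C: "C \<subseteq> S" "independent C" "S \<subseteq> span C" "card C = dim S"
    using basis_exists by blast
  moreover have "finite C"
    using independent_span_bound[of B C] assms C(2) by simp
  ultimately show ?thesis using that by blast
qed

lemma dim_Int_hyperplane:
  fixes S :: "'a::real_inner set"
  assumes B: "finite B" "span B = (UNIV :: 'a set)"
    and S: "subspace S" and u: "u \<in> S" "\<beta> \<bullet> u \<noteq> 0"
  shows "dim S = Suc (dim (S \<inter> {v. \<beta> \<bullet> v = 0}))"
proof -
  let ?H = "{v. \<beta> \<bullet> v = 0}"
  have H: "subspace ?H"
    by (auto simp: subspace_def inner_add_right)
  obtain C where C: "C \<subseteq> S \<inter> ?H" "finite C" "independent C" "S \<inter> ?H \<subseteq> span C"
      "card C = dim (S \<inter> ?H)"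
    using finite_basis_exists[OF B] by blast
  have CH: "span C \<subseteq> ?H" using C(1) H by (intro span_minimal) auto
  have uC: "u \<notin> span C" using CH u by auto
  have "independent (insert u C)" using uC C(3) by (simp add: independent_insert)
  moreover have "insert u C \<subseteq> S" using C u by auto
  moreover have "S \<subseteq> span (insert u C)"
  proof
    fix x assume x: "x \<in> S"
    \<comment> \<open>The coefficient is chosen so that \<open>x - ?k *\<^sub>R u\<close> lies in
      the hyperplane.\<close>
    let ?k = "(\<beta> \<bullet> x) / (\<beta> \<bullet> u)"
    have "x - ?k *\<^sub>R u \<in> S \<inter> ?H"
      using x u S by (auto simp: inner_diff_right subspace_diff subspace_scale)
    then have "x - ?k *\<^sub>R u \<in> span C" using C(4) by blast
    then show "x \<in> span (insert u C)" by (metis span_breakdown_eq)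
  qed
  ultimately have "dim S = card (insert u C)" by (metis dim_unique)
  moreover have "u \<notin> C" using uC span_base by blast
  ultimately show ?thesis using C by simp
qed

lemma dim_linear_inj_image:
  fixes f :: "'a::real_vector \<Rightarrow> 'a" and S :: "'a set"
  assumes f: "linear f" "inj f"
  shows "dim (f ` S) = dim S"
proof -
  obtain C where C: "C \<subseteq> S" "independent C" "S \<subseteq> span C" "card C = dim S"
    using basis_exists by blast
  have "independent (f ` C)"
    using C(2) f by (metis linear_independent_injective_image inj_on_subset subset_UNIV)
  moreover have "f ` S \<subseteq> span (f ` C)"
    using C(3) linear_span_image[OF f(1)] by blast
  ultimately have "dim (f ` S) = card (f ` C)"
    using C(1) by (metis dim_unique image_mono)
  also have "\<dots> = card C" using f(2) by (metis card_image inj_on_subset subset_UNIV)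
  finally show ?thesis using C by simp
qed

text \<open>An induction takes the place of orthogonal projection. \<open>\<beta>\<close> is
  generalized because the hypothesis is also applied to the new vector \<open>\<gamma>\<close> and
  to a corrected \<open>\<beta>\<close>.\<close>

lemma exists_separating_orthogonal:
  fixes \<beta> :: "'a::real_inner"
  assumes "finite K" "\<beta> \<notin> span K"
  shows "\<exists>\<omega>. \<beta> \<bullet> \<omega> \<noteq> 0 \<and> (\<forall>\<gamma>\<in>K. \<gamma> \<bullet> \<omega> = 0)"
  using assms
proof (induction K arbitrary: \<beta> rule: finite_induct)
  case empty
  then show ?case by (intro exI[of _ \<beta>]) auto
next
  case (insert \<gamma> K)
  show ?case
  proof (cases "\<gamma> \<in> span K")
    case True
    have "\<beta> \<notin> span K" using insert.prems span_mono[of K "insert \<gamma> K"] by auto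
    then obtain \<omega> where w: "\<beta> \<bullet> \<omega> \<noteq> 0" "\<forall>\<delta>\<in>K. \<delta> \<bullet> \<omega> = 0" using insert.IH by blast
    have "subspace {v. v \<bullet> \<omega> = 0}" by (auto simp: subspace_def inner_add_left)
    then have "span K \<subseteq> {v. v \<bullet> \<omega> = 0}" using w by (intro span_minimal) auto
    then show ?thesis using True w by blast
  next
    case False
    then obtain p where p: "\<gamma> \<bullet> p \<noteq> 0" "\<forall>\<delta>\<in>K. \<delta> \<bullet> p = 0" using insert.IH by blast
    let ?c = "(\<beta> \<bullet> p) / (\<gamma> \<bullet> p)"
    have "\<beta> - ?c *\<^sub>R \<gamma> \<notin> span K" using insert.prems by (metis span_breakdown_eq)
    then obtain q where q: "(\<beta> - ?c *\<^sub>R \<gamma>) \<bullet> q \<noteq> 0" "\<forall>\<delta>\<in>K. \<delta> \<bullet> q = 0" using insert.IH by blast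
    show ?thesis
      \<comment> \<open>Subtracting the multiple of \<open>p\<close> makes \<open>q\<close>
        orthogonal to \<open>\<gamma>\<close>. By the choice of \<open>?c\<close>, the product of
        \<open>\<beta>\<close> with the result is
        \<open>(\<beta> - ?c *\<^sub>R \<gamma>) \<bullet> q\<close>, which is nonzero.\<close>
      using p q by (intro exI[of _ "q - ((\<gamma> \<bullet> q) / (\<gamma> \<bullet> p)) *\<^sub>R p"])
        (auto simp: inner_diff_right inner_diff_left field_simps)
  qed
qed

text \<open>
  The sign vector of \<open>v\<close> encodes the face of the arrangement which contains \<open>v\<close>, and its support is the
  flat spanned by that face.
\<close>

definition sign_vector :: "'a::real_inner set \<Rightarrow> 'a \<Rightarrow> 'a \<Rightarrow> real" where
  "sign_vector A v = (\<lambda>\<alpha>. if \<alpha> \<in> A then sgn (\<alpha> \<bullet> v) else 0)"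

definition sign_support :: "'a::real_inner set \<Rightarrow> ('a \<Rightarrow> real) \<Rightarrow> 'a set" where
  "sign_support A \<sigma> = {u. \<forall>\<alpha>\<in>A. \<sigma> \<alpha> = 0 \<longrightarrow> \<alpha> \<bullet> u = 0}"

lemma subspace_sign_support: "subspace (sign_support A \<sigma>)"
  by (auto simp: subspace_def sign_support_def inner_add_right)

lemma sign_vector_eq_iff:
  "sign_vector A u = sign_vector A v \<longleftrightarrow> (\<forall>\<alpha>\<in>A. sgn (\<alpha> \<bullet> u) = sgn (\<alpha> \<bullet> v))"
  by (auto simp: sign_vector_def fun_eq_iff)

lemma mem_sign_support_sign_vector:
  "u \<in> sign_support A (sign_vector A v) \<longleftrightarrow> (\<forall>\<alpha>\<in>A. \<alpha> \<bullet> v = 0 \<longrightarrow> \<alpha> \<bullet> u = 0)"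
  by (auto simp: sign_support_def sign_vector_def sgn_zero_iff)

text \<open>Nonzero signs survive small moves, and one \<open>e\<close> serves finitely many of
  them. Both directions are recorded because a point on a hyperplane has to be pushed to either side
  of it.\<close>

lemma sign_vector_perturb:
  fixes v u :: "'a::real_inner"
  assumes "finite A"
  shows "\<exists>e>0. \<forall>\<alpha>\<in>A. \<alpha> \<bullet> v \<noteq> 0 \<longrightarrow>
    sgn (\<alpha> \<bullet> (v + e *\<^sub>R u)) = sgn (\<alpha> \<bullet> v) \<and> sgn (\<alpha> \<bullet> (v - e *\<^sub>R u)) = sgn (\<alpha> \<bullet> v)"
proof -
  have "\<exists>e>0. \<forall>\<alpha>\<in>A. \<alpha> \<bullet> v \<noteq> 0 \<longrightarrow> e * \<bar>\<alpha> \<bullet> u\<bar> < \<bar>\<alpha> \<bullet> v\<bar>"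
    using assms
  proof (induction A rule: finite_induct)
    case empty
    then show ?case by (intro exI[of _ 1]) simp
  next
    case (insert \<beta> A)
    then obtain e where e: "e > 0" "\<forall>\<alpha>\<in>A. \<alpha> \<bullet> v \<noteq> 0 \<longrightarrow> e * \<bar>\<alpha> \<bullet> u\<bar> < \<bar>\<alpha> \<bullet> v\<bar>"
      by blast
    \<comment> \<open>The summand 1 keeps the denominator positive when
      \<open>\<beta> \<bullet> u = 0\<close>, and it makes the bound below strict.\<close>
    define d where "d = (if \<beta> \<bullet> v = 0 then e else min e (\<bar>\<beta> \<bullet> v\<bar> / (\<bar>\<beta> \<bullet> u\<bar> + 1)))"
    have d: "0 < d" "d \<le> e" using e(1) by (auto simp: d_def add_nonneg_pos)
    have "d * \<bar>\<beta> \<bullet> u\<bar> < \<bar>\<beta> \<bullet> v\<bar>" if "\<beta> \<bullet> v \<noteq> 0"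
    proof -
      have "d * \<bar>\<beta> \<bullet> u\<bar> < d * (\<bar>\<beta> \<bullet> u\<bar> + 1)" using d by simp
      also have "\<dots> \<le> (\<bar>\<beta> \<bullet> v\<bar> / (\<bar>\<beta> \<bullet> u\<bar> + 1)) * (\<bar>\<beta> \<bullet> u\<bar> + 1)"
        using that by (intro mult_right_mono) (auto simp: d_def)
      also have "\<dots> = \<bar>\<beta> \<bullet> v\<bar>" by (simp add: add_nonneg_eq_0_iff)
      finally show ?thesis .
    qed
    moreover have "d * \<bar>\<alpha> \<bullet> u\<bar> < \<bar>\<alpha> \<bullet> v\<bar>" if "\<alpha> \<in> A" "\<alpha> \<bullet> v \<noteq> 0" for \<alpha>
      using e(2) that d mult_right_mono[of d e "\<bar>\<alpha> \<bullet> u\<bar>"] by force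
    ultimately show ?case using d by blast
  qed
  then obtain e where e: "e > 0" "\<And>\<alpha>. \<alpha> \<in> A \<Longrightarrow> \<alpha> \<bullet> v \<noteq> 0 \<Longrightarrow> \<bar>e * (\<alpha> \<bullet> u)\<bar> < \<bar>\<alpha> \<bullet> v\<bar>"
    by (auto simp: abs_mult)
  have "sgn (a + b) = sgn a \<and> sgn (a - b) = sgn a" if "\<bar>b\<bar> < \<bar>a\<bar>" for a b :: real
    using that by (auto simp: sgn_if)
  then show ?thesis
    using e by (intro exI[of _ e]) (auto simp: inner_add_right inner_diff_right)
qed

lemma sign_vector_insert:
  "sign_vector (insert \<beta> A) v = (sign_vector A v)(\<beta> := sgn (\<beta> \<bullet> v))"
  by (auto simp: sign_vector_def)

lemma finite_sign_vectors: "finite A \<Longrightarrow> finite (sign_vector A ` S)"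
proof (induction A rule: finite_induct)
  case empty
  have "sign_vector {} ` S \<subseteq> {\<lambda>_. 0}" by (auto simp: sign_vector_def)
  then show ?case by (rule finite_subset) simp
next
  case (insert \<beta> A)
  have "sign_vector (insert \<beta> A) ` S \<subseteq> (\<lambda>(\<sigma>, s). \<sigma>(\<beta> := s)) ` (sign_vector A ` S \<times> {-1, 0, 1})"
    by (auto simp: sign_vector_insert image_iff sgn_if)
  then show ?case by (rule finite_subset) (use insert in simp)
qed

lemma sgn_positive_combination:
  fixes x y :: real
  assumes "a > 0" "b > 0" "sgn x = sgn y"
  shows "sgn (a * x + b * y) = sgn y"
proof (cases y "0::real" rule: linorder_cases)
  case less
  then have "x < 0" using assms(3) by (simp add: sgn_if split: if_splits)
  then have "a * x + b * y < 0" using assms less by (intro add_neg_neg mult_pos_neg)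
  then show ?thesis using less by simp
next
  case equal
  then have "x = 0" using assms(3) by (simp add: sgn_zero_iff)
  then show ?thesis using equal by simp
next
  case greater
  then have "x > 0" using assms(3) by (simp add: sgn_if split: if_splits)
  then have "a * x + b * y > 0" using assms greater by (intro add_pos_pos mult_pos_pos)
  then show ?thesis using greater by simp
qed

text \<open>
  Adding a hyperplane that cuts a face of dimension \<open>d\<close> replaces it by two faces of dimension \<open>d\<close> and one
  of dimension \<open>d - 1\<close>, which does not change the alternating sum.
\<close>

lemma euler_sign_vectors:
  fixes S :: "'a::real_inner set"
  assumes B: "finite B" "span B = (UNIV :: 'a set)" and S: "subspace S" and A: "finite A"
  shows "(\<Sum>\<sigma>\<in>sign_vector A ` S. (- 1) ^ dim (S \<inter> sign_support A \<sigma>)) = ((- 1) ^ dim S :: real)"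
  using A
proof (induction A rule: finite_induct)
  case empty
  have "sign_vector {} ` S = {\<lambda>_. 0}" using subspace_0[OF S] by (auto simp: sign_vector_def)
  then show ?case by (simp add: sign_support_def)
next
  case (insert \<beta> A)
  \<comment> \<open>\<open>?r\<close> forgets the sign at \<open>\<beta>\<close>, so it sends a face
    of the larger arrangement to the old face containing it. The sum is then evaluated over each
    fibre.\<close>
  let ?r = "\<lambda>\<sigma>::'a \<Rightarrow> real. \<sigma>(\<beta> := 0)"
  let ?h = "\<lambda>A \<sigma>. (- 1) ^ dim (S \<inter> sign_support A \<sigma>) :: real"
  have r: "?r (sign_vector (insert \<beta> A) v) = sign_vector A v" for v
    using insert by (auto simp: sign_vector_def fun_eq_iff)
  then have im: "?r ` sign_vector (insert \<beta> A) ` S = sign_vector A ` S"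
    by (simp add: image_image)
  have fib: "(\<Sum>\<tau>\<in>{\<tau> \<in> sign_vector (insert \<beta> A) ` S. ?r \<tau> = \<sigma>}. ?h (insert \<beta> A) \<tau>) = ?h A \<sigma>"
    if "\<sigma> \<in> sign_vector A ` S" for \<sigma>
  proof -
    obtain v where v: "v \<in> S" "\<sigma> = sign_vector A v" using \<open>\<sigma> \<in> _\<close> by blast
    \<comment> \<open>\<open>F\<close> is the old face, \<open>E\<close> the subspace it spans, and
      \<open>T\<close> the set of signs of \<open>\<beta>\<close> on \<open>F\<close>; the new faces
      inside \<open>F\<close> correspond to the elements of \<open>T\<close>.\<close>
    define F where "F = {u \<in> S. sign_vector A u = \<sigma>}"
    define E where "E = S \<inter> sign_support A \<sigma>"
    define T where "T = (\<lambda>u. sgn (\<beta> \<bullet> u)) ` F"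
    have E: "subspace E" unfolding E_def by (intro subspace_inter S subspace_sign_support)
    have vF: "v \<in> F" using v by (simp add: F_def)
    have FE: "F \<subseteq> E" by (auto simp: F_def E_def mem_sign_support_sign_vector)
    \<comment> \<open>A face is relatively open in its span.\<close>
    have move: "\<exists>e>0. w + e *\<^sub>R u \<in> F \<and> w - e *\<^sub>R u \<in> F" if w: "w \<in> F" and u: "u \<in> E" for u w
    proof -
      obtain e where e: "e > 0" "\<forall>\<alpha>\<in>A. \<alpha> \<bullet> w \<noteq> 0 \<longrightarrow>
        sgn (\<alpha> \<bullet> (w + e *\<^sub>R u)) = sgn (\<alpha> \<bullet> w) \<and> sgn (\<alpha> \<bullet> (w - e *\<^sub>R u)) = sgn (\<alpha> \<bullet> w)"
        using sign_vector_perturb[OF insert.hyps(1)] by blast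
      have z: "\<alpha> \<bullet> u = 0" if "\<alpha> \<in> A" "\<alpha> \<bullet> w = 0" for \<alpha>
        using u w that by (auto simp: E_def F_def mem_sign_support_sign_vector)
      have "sgn (\<alpha> \<bullet> (w + e *\<^sub>R u)) = sgn (\<alpha> \<bullet> w) \<and> sgn (\<alpha> \<bullet> (w - e *\<^sub>R u)) = sgn (\<alpha> \<bullet> w)"
        if "\<alpha> \<in> A" for \<alpha>
        using e(2) z[OF that] that by (cases "\<alpha> \<bullet> w = 0") (auto simp: inner_add_right inner_diff_right)
      then have "sign_vector A (w + e *\<^sub>R u) = sign_vector A w"
          "sign_vector A (w - e *\<^sub>R u) = sign_vector A w"
        unfolding sign_vector_eq_iff by auto
      moreover have "w + e *\<^sub>R u \<in> S" "w - e *\<^sub>R u \<in> S"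
        using w u S by (auto simp: F_def E_def subspace_add subspace_diff subspace_scale)
      ultimately show ?thesis using w e(1) by (auto simp: F_def)
    qed
    \<comment> \<open>A face is a convex cone.\<close>
    have cvx: "a *\<^sub>R u + b *\<^sub>R w \<in> F" if u: "u \<in> F" and w: "w \<in> F" and ab: "a > 0" "b > 0" for a b u w
    proof -
      have "sgn (\<alpha> \<bullet> (a *\<^sub>R u + b *\<^sub>R w)) = sgn (\<alpha> \<bullet> w)" if "\<alpha> \<in> A" for \<alpha>
      proof -
        have s: "sgn (\<alpha> \<bullet> u) = sgn (\<alpha> \<bullet> w)"
          using u w that by (auto simp: F_def sign_vector_eq_iff v)
        show ?thesis using sgn_positive_combination[OF ab s] by (simp add: inner_add_right)
      qed
      then show ?thesis using u w S
        by (auto simp: F_def v sign_vector_eq_iff subspace_add subspace_scale)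
    qed
    have "{\<tau> \<in> sign_vector (insert \<beta> A) ` S. ?r \<tau> = \<sigma>} = (\<lambda>s. \<sigma>(\<beta> := s)) ` T"
      unfolding T_def F_def using r by (auto simp: sign_vector_insert image_iff)
    moreover have "inj_on (\<lambda>s. \<sigma>(\<beta> := s)) T" by (auto simp: inj_on_def fun_upd_eqD)
    ultimately have "(\<Sum>\<tau>\<in>{\<tau> \<in> sign_vector (insert \<beta> A) ` S. ?r \<tau> = \<sigma>}. ?h (insert \<beta> A) \<tau>)
        = (\<Sum>s\<in>T. ?h (insert \<beta> A) (\<sigma>(\<beta> := s)))"
      by (simp add: sum.reindex)
    also have "\<dots> = (\<Sum>s\<in>T. if s = 0 then (- 1) ^ dim (E \<inter> {u. \<beta> \<bullet> u = 0}) else (- 1) ^ dim E)"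
    proof (rule sum.cong[OF refl])
      fix s
      have "S \<inter> sign_support (insert \<beta> A) (\<sigma>(\<beta> := s)) = (if s = 0 then E \<inter> {u. \<beta> \<bullet> u = 0} else E)"
        using insert.hyps(2) by (auto simp: E_def sign_support_def)
      then show "?h (insert \<beta> A) (\<sigma>(\<beta> := s))
          = (if s = 0 then (- 1) ^ dim (E \<inter> {u. \<beta> \<bullet> u = 0}) else (- 1) ^ dim E)"
        by simp
    qed
    \<comment> \<open>If the hyperplane cuts \<open>E\<close> properly, \<open>T\<close> is a single
      nonzero sign or all three signs: openness turns a zero into both signs, convexity turns both
      signs into a zero. With all three, two terms of dimension \<open>dim E\<close> and one of
      dimension one less add up to the claimed sign.\<close>
    also have "\<dots> = (- 1) ^ dim E"
    proof (cases "E \<subseteq> {u. \<beta> \<bullet> u = 0}")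
      case True
      then have "T = {0}" using FE vF by (force simp: T_def)
      moreover have "E \<inter> {u. \<beta> \<bullet> u = 0} = E" using True by blast
      ultimately show ?thesis by simp
    next
      case False
      then obtain x where x: "x \<in> E" "\<beta> \<bullet> x \<noteq> 0" by blast
      obtain u where u: "u \<in> E" "\<beta> \<bullet> u > 0"
      proof (cases "\<beta> \<bullet> x > 0")
        case False
        then show thesis using x subspace_neg[OF E x(1)] that[of "- x"] by simp
      qed (use x that in blast)
      have dimE: "dim E = Suc (dim (E \<inter> {u. \<beta> \<bullet> u = 0}))"
        using dim_Int_hyperplane[OF B E u(1)] u(2) by simp
      have T01: "T \<subseteq> {-1, 0, 1}" by (auto simp: T_def sgn_if)
      have mem_T: "s \<in> T \<longleftrightarrow> (\<exists>w\<in>F. sgn (\<beta> \<bullet> w) = s)" for s by (auto simp: T_def)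
      have T0: "1 \<in> T \<and> - 1 \<in> T" if T0: "0 \<in> T"
      proof -
        obtain w where w: "w \<in> F" "\<beta> \<bullet> w = 0" using T0 by (auto simp: mem_T sgn_zero_iff)
        then obtain e where e: "e > 0" "w + e *\<^sub>R u \<in> F" "w - e *\<^sub>R u \<in> F"
          using move u by blast
        have "sgn (\<beta> \<bullet> (w + e *\<^sub>R u)) = 1" "sgn (\<beta> \<bullet> (w - e *\<^sub>R u)) = - 1"
          using w e(1) u by (simp_all add: inner_add_right inner_diff_right)
        then show ?thesis using e(2,3) unfolding mem_T by blast
      qed
      have T1: "0 \<in> T" if T1: "1 \<in> T" "- 1 \<in> T"
      proof -
        obtain x y where xy: "x \<in> F" "\<beta> \<bullet> x > 0" "y \<in> F" "\<beta> \<bullet> y < 0"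
          using T1 unfolding mem_T sgn_1_pos sgn_1_neg by blast
        \<comment> \<open>These positive weights make \<open>\<beta>\<close> vanish on the
          combination.\<close>
        then have "(- (\<beta> \<bullet> y)) *\<^sub>R x + (\<beta> \<bullet> x) *\<^sub>R y \<in> F" by (intro cvx) auto
        moreover have "sgn (\<beta> \<bullet> ((- (\<beta> \<bullet> y)) *\<^sub>R x + (\<beta> \<bullet> x) *\<^sub>R y)) = 0"
          by (simp add: inner_diff_right)
        ultimately show ?thesis unfolding mem_T by blast
      qed
      have "T \<noteq> {}" using vF by (auto simp: T_def)
      with T0 T1 T01 have "T = {1} \<or> T = {- 1} \<or> T = {-1, 0, 1}" by blast
      then show ?thesis using dimE by auto
    qed
    finally show ?thesis by (simp add: E_def)
  qed
  have "(\<Sum>\<tau>\<in>sign_vector (insert \<beta> A) ` S. ?h (insert \<beta> A) \<tau>)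
      = (\<Sum>\<sigma>\<in>?r ` sign_vector (insert \<beta> A) ` S.
          \<Sum>\<tau>\<in>{\<tau> \<in> sign_vector (insert \<beta> A) ` S. ?r \<tau> = \<sigma>}. ?h (insert \<beta> A) \<tau>)"
    by (rule sum.image_gen) (use insert finite_sign_vectors in blast)
  also have "\<dots> = (\<Sum>\<sigma>\<in>sign_vector A ` S. ?h A \<sigma>)"
    unfolding im by (rule sum.cong[OF refl fib])
  finally show ?case using insert.IH by simp
qed

text \<open>No finite union of proper subspaces covers \<open>S\<close>: a point is nudged off one
  more hyperplane by a move too small to bring it onto any that it already avoids. This gives a face
  spanning each flat, and a generic point on the hyperplane of a root.\<close>

lemma generic_point:
  fixes S :: "'a::real_inner set"
  assumes S: "subspace S" and A: "finite A"
  shows "\<exists>v\<in>S. \<forall>\<alpha>\<in>A. \<alpha> \<bullet> v = 0 \<longrightarrow> (\<forall>u\<in>S. \<alpha> \<bullet> u = 0)"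
  using A
proof (induction A rule: finite_induct)
  case empty
  then show ?case using subspace_0[OF S] by blast
next
  case (insert \<beta> A)
  then obtain v where v: "v \<in> S" "\<forall>\<alpha>\<in>A. \<alpha> \<bullet> v = 0 \<longrightarrow> (\<forall>u\<in>S. \<alpha> \<bullet> u = 0)" by blast
  show ?case
  proof (cases "\<beta> \<bullet> v = 0 \<longrightarrow> (\<forall>u\<in>S. \<beta> \<bullet> u = 0)")
    case True
    then show ?thesis using v by blast
  next
    case False
    then obtain u where u: "u \<in> S" "\<beta> \<bullet> u \<noteq> 0" "\<beta> \<bullet> v = 0" by blast
    obtain e where e: "e > 0" "\<forall>\<alpha>\<in>A. \<alpha> \<bullet> v \<noteq> 0 \<longrightarrow> sgn (\<alpha> \<bullet> (v + e *\<^sub>R u)) = sgn (\<alpha> \<bullet> v)"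
      using sign_vector_perturb[OF insert.hyps(1), of v u] by blast
    have "v + e *\<^sub>R u \<in> S" using v u S by (simp add: subspace_add subspace_scale)
    moreover have "\<beta> \<bullet> (v + e *\<^sub>R u) \<noteq> 0" using u e by (simp add: inner_add_right)
    moreover have "\<forall>u\<in>S. \<alpha> \<bullet> u = 0" if "\<alpha> \<in> A" "\<alpha> \<bullet> (v + e *\<^sub>R u) = 0" for \<alpha>
      using e(2) v(2) that by (metis sgn_0 sgn_zero_iff)
    ultimately show ?thesis by blast
  qed
qed

section \<open>Reflection groups and the fundamental chamber\<close>

lemma linear_reflection: "linear (reflection \<alpha>)"
  by (rule linearI) (simp_all add: reflection_def inner_add_left algebra_simps add_divide_distrib)

lemma inner_reflection: "reflection \<alpha> u \<bullet> reflection \<alpha> v = u \<bullet> v"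
proof (cases "\<alpha> = 0")
  case False
  then show ?thesis
    by (simp add: reflection_def inner_diff_left inner_diff_right inner_commute field_simps)
qed (simp add: reflection_def)

lemma reflection_self: "reflection \<alpha> \<alpha> = - \<alpha>"
  by (cases "\<alpha> = 0") (simp_all add: reflection_def scaleR_2)

lemma reflection_reflection [simp]: "reflection \<alpha> (reflection \<alpha> v) = v"
proof (cases "\<alpha> = 0")
  case False
  then show ?thesis
    by (simp add: reflection_def inner_diff_left)
qed (simp add: reflection_def)

lemma reflection_eq_iff: "reflection \<alpha> v = v \<longleftrightarrow> \<alpha> \<bullet> v = 0"
  by (auto simp: reflection_def inner_commute)

lemma reflection_minus: "reflection (- \<alpha>) = reflection \<alpha>"
  by (simp add: fun_eq_iff reflection_def)

lemma reflection_conj: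
  assumes "linear g" "\<And>u v. g u \<bullet> g v = u \<bullet> v"
  shows "g (reflection \<alpha> v) = reflection (g \<alpha>) (g v)"
  by (simp add: reflection_def linear_diff[OF assms(1)] linear_scale[OF assms(1)] assms(2))

text \<open>Keeping the word, and not only the map, provides letters to delete and a length to
  induct on.\<close>

fun word_map :: "'a::real_inner list \<Rightarrow> 'a \<Rightarrow> 'a" where
  "word_map [] = id"
| "word_map (\<alpha> # as) = reflection \<alpha> \<circ> word_map as"

lemma linear_word_map: "linear (word_map as)"
proof (induction as)
  case (Cons \<alpha> as)
  then show ?case unfolding word_map.simps by (intro linear_compose linear_reflection)
qed (simp add: linear_id[unfolded id_def])

lemma inner_word_map: "word_map as u \<bullet> word_map as v = u \<bullet> v"
  by (induction as) (auto simp: inner_reflection)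

lemma word_map_append: "word_map (as @ bs) = word_map as \<circ> word_map bs"
  by (induction as) auto

lemma word_map_rev [simp]: "word_map (rev as) (word_map as v) = v"
  by (induction as arbitrary: v) (auto simp: word_map_append)

lemma word_map_rev' [simp]: "word_map as (word_map (rev as) v) = v"
  by (metis word_map_rev rev_rev_ident)

lemma bij_word_map: "bij (word_map as)"
  by (rule o_bij[of "word_map (rev as)"]) (auto simp: fun_eq_iff)

lemma bij_reflection: "bij (reflection \<alpha>)"
  using bij_word_map[of "[\<alpha>]"] by simp

lemma inner_word_map_left: "word_map as u \<bullet> v = u \<bullet> word_map (rev as) v"
  by (metis inner_word_map word_map_rev')

lemma reflection_group_eq: "reflection_group K = word_map ` lists K"
proof (intro subset_antisym subsetI)
  have Bij: "f \<in> Bij UNIV \<longleftrightarrow> bij f" for f :: "'a \<Rightarrow> 'a"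
    by (simp add: Bij_def)
  have one: "\<one>\<^bsub>BijGroup UNIV\<^esub> = (id :: 'a \<Rightarrow> 'a)"
    by (simp add: BijGroup_def fun_eq_iff)
  have mult: "f \<otimes>\<^bsub>BijGroup UNIV\<^esub> g = f \<circ> g" if "bij f" "bij g" for f g :: "'a \<Rightarrow> 'a"
    using that by (simp add: BijGroup_def Bij compose_def fun_eq_iff)
  have inv: "inv\<^bsub>BijGroup UNIV\<^esub> (reflection \<alpha>) = reflection \<alpha>" for \<alpha> :: 'a
    using bij_reflection[of \<alpha>]
    by (simp add: inv_BijGroup Bij fun_eq_iff inv_into_f_eq bij_is_inj)
  {
    fix w assume "w \<in> reflection_group K"
    then have "w \<in> generate (BijGroup UNIV) (reflection ` K)" by (simp add: reflection_group_def)
    then show "w \<in> word_map ` lists K"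
    proof induction
      case one
      then show ?case by (auto simp: \<open>\<one>\<^bsub>BijGroup UNIV\<^esub> = id\<close> intro: image_eqI[of _ _ "[]"])
    next
      case (incl h)
      then obtain \<alpha> where "\<alpha> \<in> K" "h = reflection \<alpha>" by blast
      then show ?case by (intro image_eqI[of _ _ "[\<alpha>]"]) auto
    next
      case (inv h)
      then obtain \<alpha> where "\<alpha> \<in> K" "h = reflection \<alpha>" by blast
      then show ?case by (intro image_eqI[of _ _ "[\<alpha>]"]) (auto simp: \<open>\<And>\<alpha>. inv\<^bsub>BijGroup UNIV\<^esub> (reflection \<alpha>) = reflection \<alpha>\<close>)
    next
      case (eng g h)
      then obtain as bs where "as \<in> lists K" "g = word_map as" "bs \<in> lists K" "h = word_map bs" by blast
      then show ?case
        by (intro image_eqI[of _ _ "as @ bs"]) (simp_all add: mult bij_word_map word_map_append)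
    qed
  }
  {
    fix w assume "w \<in> word_map ` lists K"
    then obtain as where as: "as \<in> lists K" "w = word_map as" by blast
    have "word_map as \<in> generate (BijGroup UNIV) (reflection ` K)"
      using as(1)
    proof (induction as)
      case Nil
      then show ?case using generate.one[of "BijGroup UNIV"] by (metis one word_map.simps(1))
    next
      case (Cons \<alpha> as)
      have "reflection \<alpha> \<otimes>\<^bsub>BijGroup UNIV\<^esub> word_map as \<in> generate (BijGroup UNIV) (reflection ` K)"
        by (rule generate.eng) (use Cons in \<open>auto intro: generate.incl\<close>)
      then show ?case unfolding mult[OF bij_reflection bij_word_map] word_map.simps .
    qed
    then show "w \<in> reflection_group K" by (simp add: reflection_group_def as)
  }
qed

lemma word_map_in_reflection_group: "as \<in> lists K \<Longrightarrow> word_map as \<in> reflection_group K"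
  by (simp add: reflection_group_eq)

lemma id_in_reflection_group: "id \<in> reflection_group K"
  using word_map_in_reflection_group[of "[]" K] by simp

lemma reflection_in_reflection_group: "\<alpha> \<in> K \<Longrightarrow> reflection \<alpha> \<in> reflection_group K"
  using word_map_in_reflection_group[of "[\<alpha>]" K] by simp

lemma Fix_reflection_group: "Fix (reflection_group K) = {v. \<forall>\<alpha>\<in>K. \<alpha> \<bullet> v = 0}"
proof (intro subset_antisym subsetI CollectI ballI)
  fix v \<alpha> assume v: "v \<in> Fix (reflection_group K)" and "\<alpha> \<in> K"
  then have "reflection \<alpha> v = v" using v reflection_in_reflection_group by (auto simp: Fix_def)
  then show "\<alpha> \<bullet> v = 0" by (simp add: reflection_eq_iff)
next
  fix v assume v: "v \<in> {v. \<forall>\<alpha>\<in>K. \<alpha> \<bullet> v = 0}"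
  have "word_map as v = v" if "as \<in> lists K" for as
    using that by (induction as) (use v in \<open>auto simp: reflection_eq_iff\<close>)
  then show "v \<in> Fix (reflection_group K)" by (auto simp: Fix_def reflection_group_eq)
qed

lemma reflection_group_fixes:
  assumes "w \<in> reflection_group K" "\<forall>\<alpha>\<in>K. \<alpha> \<bullet> v = 0"
  shows "w v = v"
  using Fix_reflection_group[of K] assms by (auto simp: Fix_def)

lemma comp_in_reflection_group:
  assumes "u \<in> reflection_group K" "w \<in> reflection_group K"
  shows "u \<circ> w \<in> reflection_group K"
proof -
  obtain as bs where "as \<in> lists K" "u = word_map as" "bs \<in> lists K" "w = word_map bs"
    using assms by (auto simp: reflection_group_eq)
  then show ?thesis unfolding reflection_group_eq
    by (intro image_eqI[of _ _ "as @ bs"]) (simp_all add: word_map_append)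
qed

lemma reflection_group_mono: "K \<subseteq> K' \<Longrightarrow> reflection_group K \<subseteq> reflection_group K'"
  unfolding reflection_group_eq using lists_mono by blast

section \<open>Nonnegative cone of the base and the fundamental chamber\<close>

definition nonneg_cone :: "'a::real_vector set \<Rightarrow> 'a set" where
  "nonneg_cone D = {v. \<exists>c. (\<forall>\<beta>\<in>D. 0 \<le> c \<beta>) \<and> v = (\<Sum>\<beta>\<in>D. c \<beta> *\<^sub>R \<beta>)}"

definition closed_chamber :: "'a::real_inner set \<Rightarrow> 'a set" where
  "closed_chamber D = {v. \<forall>\<beta>\<in>D. 0 \<le> \<beta> \<bullet> v}"

lemma cone_inner_chamber:
  assumes "v \<in> nonneg_cone D" "x \<in> closed_chamber D"
  shows "0 \<le> v \<bullet> x"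
  using assms by (auto simp: nonneg_cone_def closed_chamber_def inner_sum_left intro!: sum_nonneg)

text \<open>A sum of nonnegative terms vanishes only termwise, so \<open>v\<close> is a combination
  of those members of \<open>D\<close> that are orthogonal to \<open>x\<close>. Thus zeros on simple
  roots control zeros on all roots.\<close>

lemma cone_inner_eq_0:
  assumes D: "finite D" and v: "v \<in> nonneg_cone D" and x: "x \<in> closed_chamber D"
    and xy: "\<And>\<beta>. \<beta> \<in> D \<Longrightarrow> \<beta> \<bullet> x = 0 \<Longrightarrow> \<beta> \<bullet> y = 0" and 0: "v \<bullet> x = 0"
  shows "v \<bullet> y = 0"
proof -
  obtain c where c: "\<forall>\<beta>\<in>D. 0 \<le> c \<beta>" "v = (\<Sum>\<beta>\<in>D. c \<beta> *\<^sub>R \<beta>)"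
    using v by (auto simp: nonneg_cone_def)
  have "(\<Sum>\<beta>\<in>D. c \<beta> * (\<beta> \<bullet> x)) = 0" using 0 c by (simp add: inner_sum_left)
  then have "\<forall>\<beta>\<in>D. c \<beta> * (\<beta> \<bullet> x) = 0"
    using D c x by (subst (asm) sum_nonneg_eq_0_iff) (auto simp: closed_chamber_def)
  then have "\<forall>\<beta>\<in>D. c \<beta> * (\<beta> \<bullet> y) = 0" using xy by auto
  then have "(\<Sum>\<beta>\<in>D. c \<beta> * (\<beta> \<bullet> y)) = 0" by (intro sum.neutral)
  then show ?thesis using c by (simp add: inner_sum_left)
qed

locale based_root_system =
  fixes \<Phi> \<Delta> :: "'a::real_inner set"
  assumes root_system: "root_system \<Phi>" and base: "root_base \<Phi> \<Delta>"
begin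

abbreviation W where "W \<equiv> reflection_group \<Phi>"
abbreviation L where "L \<equiv> intersection_lattice \<Phi>"
abbreviation C where "C \<equiv> closed_chamber \<Delta>"
abbreviation face where "face \<equiv> sign_vector \<Phi>"
abbreviation supp where "supp \<equiv> sign_support \<Phi>"

lemma finite_roots: "finite \<Phi>" and zero_not_root: "0 \<notin> \<Phi>" and span_roots: "span \<Phi> = UNIV"
  and reflection_roots: "\<alpha> \<in> \<Phi> \<Longrightarrow> reflection \<alpha> ` \<Phi> = \<Phi>"
  and root_multiples: "\<alpha> \<in> \<Phi> \<Longrightarrow> \<Phi> \<inter> span {\<alpha>} = {\<alpha>, - \<alpha>}"
  using root_system by (auto simp: root_system_def)

lemma base_subset: "\<Delta> \<subseteq> \<Phi>" and independent_base: "independent \<Delta>"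
  using base by (auto simp: root_base_def)

lemma finite_base: "finite \<Delta>"
  using base_subset finite_roots finite_subset by blast

lemma root_cases:
  assumes "\<alpha> \<in> \<Phi>"
  obtains "\<alpha> \<in> nonneg_cone \<Delta>" | "- \<alpha> \<in> nonneg_cone \<Delta>"
proof -
  obtain c where c: "\<forall>\<beta>\<in>\<Delta>. 0 \<le> c \<beta>"
      "\<alpha> = (\<Sum>\<beta>\<in>\<Delta>. c \<beta> *\<^sub>R \<beta>) \<or> \<alpha> = - (\<Sum>\<beta>\<in>\<Delta>. c \<beta> *\<^sub>R \<beta>)"
    using base assms unfolding root_base_def by blast
  then have "(\<Sum>\<beta>\<in>\<Delta>. c \<beta> *\<^sub>R \<beta>) \<in> nonneg_cone \<Delta>" by (auto simp: nonneg_cone_def)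
  then show thesis using c(2) that by auto
qed

lemma base_spans: "span \<Delta> = UNIV"
proof -
  have "v \<in> span \<Delta>" if "v \<in> nonneg_cone \<Delta>" for v
    using that by (auto simp: nonneg_cone_def intro!: span_sum span_scale intro: span_base)
  then have "\<Phi> \<subseteq> span \<Delta>"
    by (metis root_cases span_neg subsetI minus_minus)
  then show ?thesis using span_roots span_minimal[of \<Phi> "span \<Delta>"] by auto
qed

text \<open>The vectors \<open>\<omega> \<beta>\<close> of the proof pair with the base like a dual
  basis. The constant value 1 gives a point strictly inside the chamber, and values 0 and 1 give
  points on its faces.\<close>

lemma base_dual: "\<exists>\<omega>. \<forall>\<beta>\<in>\<Delta>. \<beta> \<bullet> \<omega> = f \<beta>"
proof -
  have "\<exists>\<omega>. \<beta> \<bullet> \<omega> = 1 \<and> (\<forall>\<gamma>\<in>\<Delta> - {\<beta>}. \<gamma> \<bullet> \<omega> = 0)" if "\<beta> \<in> \<Delta>" for \<beta>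
  proof -
    have "\<beta> \<notin> span (\<Delta> - {\<beta>})" using independent_base that by (auto simp: dependent_def)
    then obtain p where "\<beta> \<bullet> p \<noteq> 0" "\<forall>\<gamma>\<in>\<Delta> - {\<beta>}. \<gamma> \<bullet> p = 0"
      using exists_separating_orthogonal finite_base by (metis finite_Diff)
    then show ?thesis by (intro exI[of _ "(1 / (\<beta> \<bullet> p)) *\<^sub>R p"]) simp
  qed
  then obtain \<omega> where \<omega>: "\<And>\<beta>. \<beta> \<in> \<Delta> \<Longrightarrow> \<beta> \<bullet> \<omega> \<beta> = 1"
      "\<And>\<beta> \<gamma>. \<beta> \<in> \<Delta> \<Longrightarrow> \<gamma> \<in> \<Delta> - {\<beta>} \<Longrightarrow> \<gamma> \<bullet> \<omega> \<beta> = 0" by metis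
  have "\<gamma> \<bullet> (\<Sum>\<beta>\<in>\<Delta>. f \<beta> *\<^sub>R \<omega> \<beta>) = f \<gamma>" if "\<gamma> \<in> \<Delta>" for \<gamma>
  proof -
    have "\<gamma> \<bullet> (\<Sum>\<beta>\<in>\<Delta>. f \<beta> *\<^sub>R \<omega> \<beta>) = (\<Sum>\<beta>\<in>\<Delta>. if \<beta> = \<gamma> then f \<beta> else 0)"
      unfolding inner_sum_right using \<omega> that by (intro sum.cong) auto
    then show ?thesis using that finite_base by simp
  qed
  then show ?thesis by blast
qed

lemma cone_pointed:
  assumes "v \<in> nonneg_cone \<Delta>" "- v \<in> nonneg_cone \<Delta>"
  shows "v = 0"
proof -
  obtain c where c: "\<forall>\<beta>\<in>\<Delta>. 0 \<le> c \<beta>" "v = (\<Sum>\<beta>\<in>\<Delta>. c \<beta> *\<^sub>R \<beta>)"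
    using assms by (auto simp: nonneg_cone_def)
  obtain \<rho> where \<rho>: "\<forall>\<beta>\<in>\<Delta>. \<beta> \<bullet> \<rho> = 1" using base_dual[of "\<lambda>_. 1"] by blast
  then have "\<rho> \<in> C" by (auto simp: closed_chamber_def)
  then have "v \<bullet> \<rho> = 0"
    using cone_inner_chamber[OF assms(1)] cone_inner_chamber[OF assms(2)] by (simp add: order_antisym)
  then have "(\<Sum>\<beta>\<in>\<Delta>. c \<beta>) = 0" using \<rho> c by (simp add: inner_sum_left)
  then have "\<forall>\<beta>\<in>\<Delta>. c \<beta> = 0" using finite_base c by (subst (asm) sum_nonneg_eq_0_iff) auto
  then show ?thesis using c by simp
qed

text \<open>\<open>reflection \<alpha>\<close> changes only the coefficient of
  \<open>\<alpha>\<close>. A positive root that becomes negative can therefore have no other nonzero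
  coefficient, and its only candidates are \<open>\<alpha>\<close> and
  \<open>- \<alpha>\<close>.\<close>

lemma simple_reflection_negative:
  assumes \<alpha>: "\<alpha> \<in> \<Delta>" and \<beta>: "\<beta> \<in> \<Phi>" "\<beta> \<in> nonneg_cone \<Delta>" "- reflection \<alpha> \<beta> \<in> nonneg_cone \<Delta>"
  shows "\<beta> = \<alpha>"
proof -
  obtain c where c: "\<forall>\<gamma>\<in>\<Delta>. 0 \<le> c \<gamma>" "\<beta> = (\<Sum>\<gamma>\<in>\<Delta>. c \<gamma> *\<^sub>R \<gamma>)"
    using \<beta> by (auto simp: nonneg_cone_def)
  obtain d where d: "\<forall>\<gamma>\<in>\<Delta>. 0 \<le> d \<gamma>" "- reflection \<alpha> \<beta> = (\<Sum>\<gamma>\<in>\<Delta>. d \<gamma> *\<^sub>R \<gamma>)"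
    using \<beta> by (auto simp: nonneg_cone_def)
  define k where "k = 2 * (\<beta> \<bullet> \<alpha>) / (\<alpha> \<bullet> \<alpha>)"
  \<comment> \<open>Independence allows the coefficients in
    \<open>\<beta> - reflection \<alpha> \<beta> = k *\<^sub>R \<alpha>\<close> to be
    compared.\<close>
  have "(\<Sum>\<gamma>\<in>\<Delta>. (c \<gamma> + d \<gamma> - (if \<gamma> = \<alpha> then k else 0)) *\<^sub>R \<gamma>)
     = (\<Sum>\<gamma>\<in>\<Delta>. c \<gamma> *\<^sub>R \<gamma>) + (\<Sum>\<gamma>\<in>\<Delta>. d \<gamma> *\<^sub>R \<gamma>) - (\<Sum>\<gamma>\<in>\<Delta>. if \<gamma> = \<alpha> then k *\<^sub>R \<gamma> else 0)"
    unfolding sum.distrib[symmetric] sum_subtractf[symmetric]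
    by (intro sum.cong) (auto simp: algebra_simps)
  also have "\<dots> = \<beta> + - reflection \<alpha> \<beta> - k *\<^sub>R \<alpha>"
    using \<alpha> finite_base c(2) d(2) by simp
  also have "\<dots> = 0" by (simp add: reflection_def k_def)
  finally have z: "c \<gamma> + d \<gamma> - (if \<gamma> = \<alpha> then k else 0) = 0" if "\<gamma> \<in> \<Delta>" for \<gamma>
    using independentD[OF independent_base finite_base subset_refl _ that,
      of "\<lambda>\<gamma>. c \<gamma> + d \<gamma> - (if \<gamma> = \<alpha> then k else 0)"] by simp
  have "c \<gamma> = 0" if "\<gamma> \<in> \<Delta>" "\<gamma> \<noteq> \<alpha>" for \<gamma>
    using z[OF that(1)] c(1) d(1) that by (auto simp: add_nonneg_eq_0_iff)
  then have "\<beta> = (\<Sum>\<gamma>\<in>\<Delta>. if \<gamma> = \<alpha> then c \<gamma> *\<^sub>R \<gamma> else 0)"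
    unfolding c(2) by (intro sum.cong) auto
  then have b: "\<beta> = c \<alpha> *\<^sub>R \<alpha>" using \<alpha> finite_base by simp
  then have "\<beta> \<in> \<Phi> \<inter> span {\<alpha>}" using \<beta> by (auto simp: span_base span_scale)
  then have "\<beta> = \<alpha> \<or> \<beta> = - \<alpha>" using root_multiples \<alpha> base_subset by blast
  moreover have "\<beta> \<noteq> - \<alpha>"
  proof
    assume "\<beta> = - \<alpha>"
    then have "(c \<alpha> + 1) *\<^sub>R \<alpha> = 0" using b by (simp add: algebra_simps)
    then have "c \<alpha> + 1 = 0" using \<alpha> base_subset zero_not_root by auto
    then show False using c(1) \<alpha> by force
  qed
  ultimately show ?thesis by blast
qed

section \<open>Finiteness of the group, exchange condition and chamber stabilizers\<close>

lemma word_map_roots: "as \<in> lists \<Phi> \<Longrightarrow> word_map as ` \<Phi> = \<Phi>"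
proof (induction as)
  case (Cons \<alpha> as)
  have "word_map (\<alpha> # as) ` \<Phi> = reflection \<alpha> ` word_map as ` \<Phi>" by (simp add: image_image)
  then show ?case using Cons reflection_roots by simp
qed simp

lemma finite_W: "finite W"
proof (rule finite_imageD)
  show "finite ((\<lambda>w. restrict w \<Phi>) ` W)"
  proof (rule finite_subset)
    show "(\<lambda>w. restrict w \<Phi>) ` W \<subseteq> \<Phi> \<rightarrow>\<^sub>E \<Phi>"
      using word_map_roots by (fastforce simp: reflection_group_eq)
    show "finite (\<Phi> \<rightarrow>\<^sub>E \<Phi>)" using finite_roots by (intro finite_PiE) auto
  qed
  show "inj_on (\<lambda>w. restrict w \<Phi>) W"
  proof (rule inj_onI)
    fix u w assume uw: "u \<in> W" "w \<in> W" and eq: "restrict u \<Phi> = restrict w \<Phi>"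
    have lin: "linear u" "linear w" using uw by (auto simp: reflection_group_eq linear_word_map)
    have "u x = w x" if "x \<in> \<Phi>" for x using eq that by (metis restrict_apply')
    then have "u x = w x" if "x \<in> span \<Phi>" for x
      using linear_eq_on_span[OF lin] that by blast
    then show "u = w" using span_roots by auto
  qed
qed

text \<open>Read from the right, the word first turns \<open>\<alpha>\<close> negative at some
  letter \<open>\<gamma>\<close>. Just before that letter the image of \<open>\<alpha>\<close> is
  \<open>\<gamma>\<close> itself, so moving \<open>reflection \<alpha>\<close> leftwards to that
  place turns it into \<open>reflection \<gamma>\<close>, which cancels the letter.\<close>

lemma exchange:
  assumes "as \<in> lists \<Delta>" "\<alpha> \<in> \<Phi>" "\<alpha> \<in> nonneg_cone \<Delta>" "- word_map as \<alpha> \<in> nonneg_cone \<Delta>"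
  shows "\<exists>bs\<in>lists \<Delta>. length bs < length as \<and> word_map as \<circ> reflection \<alpha> = word_map bs"
  using assms
proof (induction as)
  case Nil
  then have "\<alpha> = 0" using cone_pointed by simp
  then show ?case using Nil zero_not_root by simp
next
  case (Cons \<gamma> as)
  let ?\<beta> = "word_map as \<alpha>"
  have \<gamma>: "\<gamma> \<in> \<Delta>" and as: "as \<in> lists \<Delta>" using Cons.hyps by simp_all
  have as': "as \<in> lists \<Phi>" using as lists_mono[OF base_subset] by blast
  have \<beta>: "?\<beta> \<in> \<Phi>" using word_map_roots[OF as'] Cons.prems by blast
  then show ?case
  proof (cases rule: root_cases)
    case 1
    then have "?\<beta> = \<gamma>" using simple_reflection_negative[OF \<gamma> \<beta>] Cons.prems by simp
    then have "(word_map (\<gamma> # as) \<circ> reflection \<alpha>) v = word_map as v" for v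
      using reflection_conj[OF linear_word_map inner_word_map, of as \<alpha>] by simp
    then show ?thesis using as by (intro bexI[of _ as] conjI ext) auto
  next
    case 2
    then obtain bs where bs: "bs \<in> lists \<Delta>" "length bs < length as"
        "word_map as \<circ> reflection \<alpha> = word_map bs"
      using Cons as by blast
    then show ?thesis using \<gamma>
      by (intro bexI[of _ "\<gamma> # bs"]) (simp_all only: word_map.simps comp_assoc, simp_all)
  qed
qed

text \<open>If the last letter \<open>\<alpha>\<close> is orthogonal to \<open>x\<close>, it belongs
  to the parabolic subgroup and is split off. Otherwise \<open>\<alpha> \<bullet> x > 0\<close>; as
  the image of \<open>x\<close> is in the chamber, the image of \<open>\<alpha>\<close> is a
  positive root, so the word without its last letter makes \<open>\<alpha>\<close> negative and
  \<open>exchange\<close> yields a shorter word. In particular two points of an orbit that lie in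
  the chamber coincide.\<close>

lemma chamber_stabilizer_word:
  assumes "as \<in> lists \<Delta>" "x \<in> C" "word_map as x \<in> C"
  shows "word_map as \<in> reflection_group {\<beta> \<in> \<Delta>. \<beta> \<bullet> x = 0}"
  using assms
proof (induction "length as" arbitrary: as rule: less_induct)
  case less
  show ?case
  proof (cases as rule: rev_cases)
    case Nil
    then show ?thesis by (simp add: id_in_reflection_group)
  next
    case (snoc bs \<alpha>)
    have \<alpha>: "\<alpha> \<in> \<Delta>" and bs: "bs \<in> lists \<Delta>" "bs \<in> lists \<Phi>" and as: "as \<in> lists \<Phi>"
      using less.prems(1) base_subset by (auto simp: snoc)
    have w: "word_map as = word_map bs \<circ> reflection \<alpha>" by (simp add: snoc word_map_append)
    show ?thesis
    proof (cases "\<alpha> \<bullet> x = 0")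
      case True
      then have "word_map bs x \<in> C" using less.prems(3) by (simp add: w reflection_eq_iff[THEN iffD2])
      then have "word_map bs \<in> reflection_group {\<beta> \<in> \<Delta>. \<beta> \<bullet> x = 0}"
        using less.hyps[of bs] bs less.prems by (simp add: snoc)
      moreover have "reflection \<alpha> \<in> reflection_group {\<beta> \<in> \<Delta>. \<beta> \<bullet> x = 0}"
        using True \<alpha> by (intro reflection_in_reflection_group) simp
      ultimately show ?thesis unfolding w by (rule comp_in_reflection_group)
    next
      case False
      then have pos: "\<alpha> \<bullet> x > 0" using less.prems(2) \<alpha> by (auto simp: closed_chamber_def less_le)
      have "word_map as \<alpha> \<in> \<Phi>" using word_map_roots[OF as] \<alpha> base_subset by blast
      then have "word_map as \<alpha> \<in> nonneg_cone \<Delta>"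
      proof (cases rule: root_cases)
        case 2
        then have "0 \<le> - word_map as \<alpha> \<bullet> word_map as x" using cone_inner_chamber less.prems(3) by blast
        then show ?thesis using pos by (simp add: inner_word_map)
      qed
      moreover have "word_map as \<alpha> = - word_map bs \<alpha>"
        by (simp add: w reflection_self linear_neg[OF linear_word_map])
      moreover have "\<alpha> \<in> nonneg_cone \<Delta>"
        unfolding nonneg_cone_def using \<alpha> finite_base
        by (auto intro!: exI[of _ "\<lambda>\<beta>. if \<beta> = \<alpha> then 1 else 0"] simp: if_distrib[of "\<lambda>c. c *\<^sub>R _"] cong: if_cong)
      ultimately obtain cs where cs: "cs \<in> lists \<Delta>" "length cs < length bs"
          "word_map bs \<circ> reflection \<alpha> = word_map cs"
        using exchange[of bs \<alpha>] bs \<alpha> base_subset by auto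
      then have "word_map as = word_map cs" "length cs < length as" using w by (simp, simp add: snoc)
      then show ?thesis using less.hyps[of cs] less.prems cs(1) by simp
    qed
  qed
qed

text \<open>In the orbit of \<open>v\<close> under the simple reflections, a point with the largest
  product with \<open>\<rho>\<close> works: a simple root negative on it would give a reflection
  that increases the product. Staying in \<open>reflection_group \<Delta>\<close> allows the use in
  the proof of \<open>W_eq\<close>.\<close>

lemma move_to_chamber: "\<exists>w\<in>reflection_group \<Delta>. w v \<in> C"
proof -
  let ?G = "reflection_group \<Delta>"
  obtain \<rho> where \<rho>: "\<forall>\<beta>\<in>\<Delta>. \<beta> \<bullet> \<rho> = 1" using base_dual[of "\<lambda>_. 1"] by blast
  have G: "finite ?G" using finite_W reflection_group_mono[OF base_subset] finite_subset by blast
  define f where "f w = w v \<bullet> \<rho>" for w :: "'a \<Rightarrow> 'a"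
  have "id \<in> ?G" by (rule id_in_reflection_group)
  then have "Max (f ` ?G) \<in> f ` ?G" using G by (intro Max_in) auto
  then obtain w where w: "Max (f ` ?G) = f w" "w \<in> ?G" by (rule imageE)
  have "0 \<le> \<beta> \<bullet> w v" if \<beta>: "\<beta> \<in> \<Delta>" for \<beta>
  proof -
    have "reflection \<beta> \<circ> w \<in> ?G" using reflection_in_reflection_group[OF \<beta>] w(2) by (rule comp_in_reflection_group)
    then have "f (reflection \<beta> \<circ> w) \<le> f w" unfolding w(1)[symmetric] using G by (intro Max_ge) auto
    then have "0 \<le> 2 * (w v \<bullet> \<beta>) / (\<beta> \<bullet> \<beta>)"
      using \<rho> \<beta> by (simp add: f_def reflection_def inner_diff_left)
    moreover have "\<beta> \<bullet> \<beta> > 0" using \<beta> base_subset zero_not_root by auto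
    ultimately show ?thesis by (simp add: zero_le_divide_iff inner_commute)
  qed
  then show ?thesis using w(2) by (auto simp: closed_chamber_def)
qed

text \<open>
  A generic point of the hyperplane of a root can be moved into the fundamental chamber, where it lies on
  the wall of some simple root; hence every root is conjugate to a multiple of a simple root.
\<close>

lemma W_eq: "W = reflection_group \<Delta>"
proof
  show "reflection_group \<Delta> \<subseteq> W" by (rule reflection_group_mono[OF base_subset])
  have refl: "reflection \<alpha> \<in> reflection_group \<Delta>" if \<alpha>: "\<alpha> \<in> \<Phi>" for \<alpha>
  proof -
    have H: "subspace {v. \<alpha> \<bullet> v = 0}" by (auto simp: subspace_def inner_add_right)
    obtain v where v: "\<alpha> \<bullet> v = 0" "\<And>\<beta> u. \<beta> \<in> \<Phi> \<Longrightarrow> \<beta> \<bullet> v = 0 \<Longrightarrow> \<alpha> \<bullet> u = 0 \<Longrightarrow> \<beta> \<bullet> u = 0"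
      using generic_point[OF H finite_roots] by blast
    obtain as where as: "as \<in> lists \<Delta>" "word_map as v \<in> C"
      using move_to_chamber by (auto simp: reflection_group_eq)
    have as': "as \<in> lists \<Phi>" "rev as \<in> lists \<Phi>" using as(1) base_subset by auto
    \<comment> \<open>A chamber point off all simple walls is orthogonal to no root, whereas the
      image of \<open>v\<close> is orthogonal to the image of \<open>\<alpha>\<close>.\<close>
    have "\<exists>\<beta>\<in>\<Delta>. \<beta> \<bullet> word_map as v = 0"
    proof (rule ccontr)
      assume neg: "\<not> ?thesis"
      have r: "word_map as \<alpha> \<in> \<Phi>" using word_map_roots as' \<alpha> by blast
      have 0: "word_map as \<alpha> \<bullet> word_map as v = 0" using v by (simp add: inner_word_map)
      have pos: "x = 0" if x: "x \<in> nonneg_cone \<Delta>" "x \<bullet> word_map as v = 0" for x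
      proof -
        have "x \<bullet> x = 0" by (rule cone_inner_eq_0[OF finite_base x(1) as(2) _ x(2)]) (use neg in blast)
        then show ?thesis by simp
      qed
      show False using r
      proof (cases rule: root_cases)
        case 1
        then show ?thesis using pos 0 r zero_not_root by metis
      next
        case 2
        then show ?thesis using pos 0 r zero_not_root by (metis inner_minus_left neg_equal_0_iff_equal)
      qed
    qed
    then obtain \<beta> where \<beta>: "\<beta> \<in> \<Delta>" "\<beta> \<bullet> word_map as v = 0" by blast
    define \<gamma> where "\<gamma> = word_map (rev as) \<beta>"
    have \<gamma>: "\<gamma> \<in> \<Phi>" using word_map_roots[OF as'(2)] \<beta> base_subset unfolding \<gamma>_def by blast
    have "\<gamma> \<bullet> v = 0" using \<beta> by (simp add: \<gamma>_def inner_word_map_left)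
    then have orth: "\<gamma> \<bullet> u = 0" if "\<alpha> \<bullet> u = 0" for u using v(2) \<gamma> that by blast
    have "\<alpha> \<bullet> \<alpha> \<noteq> 0" using \<alpha> zero_not_root by auto
    \<comment> \<open>\<open>u\<close> is the component of \<open>\<gamma>\<close> orthogonal to
      \<open>\<alpha>\<close>. Since \<open>\<gamma>\<close> vanishes on the hyperplane of
      \<open>\<alpha>\<close>, it is orthogonal to \<open>u\<close>, which forces
      \<open>u = 0\<close>.\<close>
    define u where "u = \<gamma> - ((\<gamma> \<bullet> \<alpha>) / (\<alpha> \<bullet> \<alpha>)) *\<^sub>R \<alpha>"
    have "\<alpha> \<bullet> u = 0" using \<open>\<alpha> \<bullet> \<alpha> \<noteq> 0\<close> by (simp add: u_def inner_diff_right inner_commute)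
    then have "u \<bullet> u = 0" using orth by (subst u_def) (simp add: inner_diff_left)
    then have "\<gamma> = ((\<gamma> \<bullet> \<alpha>) / (\<alpha> \<bullet> \<alpha>)) *\<^sub>R \<alpha>" by (simp add: u_def)
    then have "\<gamma> \<in> \<Phi> \<inter> span {\<alpha>}" using \<gamma> by (metis IntI singletonI span_base span_scale)
    then have "\<gamma> = \<alpha> \<or> \<gamma> = - \<alpha>" using root_multiples[OF \<alpha>] by blast
    then have \<gamma>\<alpha>: "reflection \<gamma> = reflection \<alpha>" using reflection_minus by auto
    have "reflection \<alpha> x = word_map (rev as @ \<beta> # as) x" for x
    proof -
      have "word_map (rev as) (reflection \<beta> (word_map as x)) = reflection \<gamma> x"
        using reflection_conj[OF linear_word_map inner_word_map, of "rev as" \<beta> "word_map as x"]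
        by (simp add: \<gamma>_def)
      then show ?thesis by (simp add: word_map_append \<gamma>\<alpha>)
    qed
    then have "reflection \<alpha> = word_map (rev as @ \<beta> # as)" by blast
    moreover have "rev as @ \<beta> # as \<in> lists \<Delta>" using as(1) \<beta> by auto
    ultimately show ?thesis by (simp only: word_map_in_reflection_group)
  qed
  have "word_map as \<in> reflection_group \<Delta>" if "as \<in> lists \<Phi>" for as
    using that
  proof (induction as)
    case Nil
    then show ?case unfolding word_map.simps by (intro id_in_reflection_group)
  next
    case (Cons \<alpha> as)
    then show ?case unfolding word_map.simps by (intro comp_in_reflection_group refl)
  qed
  then show "W \<subseteq> reflection_group \<Delta>" by (auto simp: reflection_group_eq[of \<Phi>])
qed

section \<open>Counting faces\<close>

lemma mem_L_iff: "X \<in> L \<longleftrightarrow> (\<exists>S\<subseteq>\<Phi>. X = {u. \<forall>\<alpha>\<in>S. \<alpha> \<bullet> u = 0})"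
proof
  assume "X \<in> L"
  then obtain S where "S \<subseteq> \<Phi>" "X = \<Inter> ((\<lambda>\<alpha>. {v. \<alpha> \<bullet> v = 0}) ` S)"
    unfolding intersection_lattice_def root_hyperplanes_def subset_image_iff by blast
  then show "\<exists>S\<subseteq>\<Phi>. X = {u. \<forall>\<alpha>\<in>S. \<alpha> \<bullet> u = 0}" by (intro exI[of _ S]) auto
next
  assume "\<exists>S\<subseteq>\<Phi>. X = {u. \<forall>\<alpha>\<in>S. \<alpha> \<bullet> u = 0}"
  then obtain S where S: "S \<subseteq> \<Phi>" "X = {u. \<forall>\<alpha>\<in>S. \<alpha> \<bullet> u = 0}" by blast
  then have "X = \<Inter> ((\<lambda>\<alpha>. {v. \<alpha> \<bullet> v = 0}) ` S)" by auto
  then show "X \<in> L" using S(1) unfolding intersection_lattice_def root_hyperplanes_def by blast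
qed

lemma finite_L: "finite L"
  by (rule finite_intersection_lattice[OF finite_roots])

lemma UNIV_in_L: "UNIV \<in> L"
  unfolding mem_L_iff by (intro exI[of _ "{}"]) auto

lemma supp_in_L: "supp \<sigma> \<in> L"
  unfolding mem_L_iff by (intro exI[of _ "{\<alpha>\<in>\<Phi>. \<sigma> \<alpha> = 0}"]) (auto simp: sign_support_def)

lemma subspace_L: "X \<in> L \<Longrightarrow> subspace X"
  by (auto simp: mem_L_iff subspace_def inner_add_right)

lemma finite_segment: "finite (segment L X)"
  using finite_L by (simp add: segment_def)

lemma finite_faces: "finite (face ` S)"
  by (rule finite_sign_vectors[OF finite_roots])

lemma mem_supp_face: "v \<in> supp (face v)"
  by (simp add: mem_sign_support_sign_vector)

lemma supp_face_subset: "X \<in> L \<Longrightarrow> v \<in> X \<Longrightarrow> supp (face v) \<subseteq> X"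
  by (auto simp: mem_L_iff mem_sign_support_sign_vector)

lemma faces_in_flat:
  assumes "X \<in> L"
  shows "{\<sigma> \<in> range face. supp \<sigma> \<subseteq> X} = face ` X"
  using supp_face_subset[OF assms] mem_supp_face by blast

lemma exists_face_spanning_flat:
  assumes "X \<in> L"
  shows "\<exists>v. supp (face v) = X"
proof -
  obtain v where v: "v \<in> X" "\<forall>\<alpha>\<in>\<Phi>. \<alpha> \<bullet> v = 0 \<longrightarrow> (\<forall>u\<in>X. \<alpha> \<bullet> u = 0)"
    using generic_point[OF subspace_L[OF assms] finite_roots] by blast
  then have "X \<subseteq> supp (face v)" by (auto simp: mem_sign_support_sign_vector)
  then show ?thesis using supp_face_subset[OF assms v(1)] by blast
qed

text \<open>Over the segment of any flat \<open>Z\<close> both sides sum to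
  \<open>(- 1) ^ dim Z\<close>. The count is written as a sum of signs so that the Euler relation
  applies to it directly.\<close>

lemma sum_faces_spanning_flat:
  assumes "X \<in> L"
  shows "(\<Sum>\<sigma>\<in>{\<sigma> \<in> range face. supp \<sigma> = X}. (- 1) ^ dim X) = poly (segment_char_poly L X) (- 1)"
proof (rule segment_sums_determine[OF finite_L _ assms])
  fix Z assume Z: "Z \<in> L"
  let ?h = "\<lambda>\<sigma>. (- 1) ^ dim (supp \<sigma>) :: real"
  have "(\<Sum>X\<in>segment L Z. \<Sum>\<sigma>\<in>{\<sigma> \<in> range face. supp \<sigma> = X}. (- 1) ^ dim X)
      = (\<Sum>X\<in>segment L Z. \<Sum>\<sigma>\<in>{\<sigma> \<in> face ` Z. supp \<sigma> = X}. ?h \<sigma>)"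
    using faces_in_flat[OF Z] by (intro sum.cong) (auto simp: segment_def)
  also have "\<dots> = (\<Sum>\<sigma>\<in>face ` Z. ?h \<sigma>)"
    by (rule sum.group)
      (use finite_faces finite_segment faces_in_flat[OF Z] supp_in_L in \<open>auto simp: segment_def\<close>)
  also have "\<dots> = (\<Sum>\<sigma>\<in>face ` Z. (- 1) ^ dim (Z \<inter> supp \<sigma>))"
  proof (rule sum.cong[OF refl])
    fix \<sigma> assume "\<sigma> \<in> face ` Z"
    then have "Z \<inter> supp \<sigma> = supp \<sigma>" using faces_in_flat[OF Z] by blast
    then show "?h \<sigma> = (- 1) ^ dim (Z \<inter> supp \<sigma>)" by simp
  qed
  also have "\<dots> = (- 1) ^ dim Z"
    by (rule euler_sign_vectors[OF finite_roots span_roots subspace_L[OF Z] finite_roots])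
  also have "\<dots> = (\<Sum>X\<in>segment L Z. poly (segment_char_poly L X) (- 1))"
    unfolding poly_segment_char_poly by (rule sum_segment_mobius[OF finite_L Z, symmetric])
  finally show "(\<Sum>X\<in>segment L Z. \<Sum>\<sigma>\<in>{\<sigma> \<in> range face. supp \<sigma> = X}. (- 1) ^ dim X)
      = (\<Sum>X\<in>segment L Z. poly (segment_char_poly L X) (- 1))" .
qed

text \<open>The value is a sign times the number of faces spanning \<open>X\<close>, and a generic
  point of \<open>X\<close> supplies such a face.\<close>

lemma segment_char_poly_at_minus_one_nonzero:
  assumes "X \<in> L"
  shows "poly (segment_char_poly L X) (- 1) \<noteq> 0"
proof -
  have "{\<sigma> \<in> range face. supp \<sigma> = X} \<noteq> {}"
    using exists_face_spanning_flat[OF assms] by blast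
  moreover have "finite {\<sigma> \<in> range face. supp \<sigma> = X}" using finite_faces by simp
  ultimately show ?thesis
    using sum_faces_spanning_flat[OF assms, symmetric] by simp
qed

text \<open>For a flat \<open>X\<close> the scalar is the reciprocal of the number of faces spanning
  \<open>X\<close>; the sign in the theorem is absorbed here.\<close>

definition flat_term :: "'a set \<Rightarrow> real poly" where
  "flat_term X = smult ((- 1) ^ dim X / poly (segment_char_poly L X) (- 1)) (segment_char_poly L X)"

lemma sum_flat_term: "(\<Sum>\<sigma>\<in>range face. flat_term (supp \<sigma>)) = monom 1 (dim (UNIV :: 'a set))"
proof -
  have "(\<Sum>\<sigma>\<in>range face. flat_term (supp \<sigma>))
      = (\<Sum>X\<in>segment L UNIV. \<Sum>\<sigma>\<in>{\<sigma> \<in> range face. supp \<sigma> = X}. flat_term (supp \<sigma>))"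
    by (rule sum.group[symmetric])
      (use finite_faces finite_L supp_in_L in \<open>auto simp: segment_def\<close>)
  also have "\<dots> = (\<Sum>X\<in>segment L UNIV. segment_char_poly L X)"
  proof (rule sum.cong[OF refl])
    fix X assume "X \<in> segment L UNIV"
    then have X: "X \<in> L" by (simp add: segment_def)
    let ?N = "{\<sigma> \<in> range face. supp \<sigma> = X}"
    have "(\<Sum>\<sigma>\<in>?N. flat_term (supp \<sigma>)) = (\<Sum>\<sigma>\<in>?N. flat_term X)"
      by (intro sum.cong) auto
    also have "\<dots> = smult ((\<Sum>\<sigma>\<in>?N. (- 1) ^ dim X) / poly (segment_char_poly L X) (- 1))
        (segment_char_poly L X)"
      by (simp add: flat_term_def of_nat_poly mult.commute)
    also have "\<dots> = segment_char_poly L X"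
      unfolding sum_faces_spanning_flat[OF X]
      using segment_char_poly_at_minus_one_nonzero[OF X] by simp
    finally show "(\<Sum>\<sigma>\<in>?N. flat_term (supp \<sigma>)) = segment_char_poly L X" .
  qed
  also have "\<dots> = monom 1 (dim (UNIV :: 'a set))"
    by (rule sum_segment_char_poly[OF finite_L UNIV_in_L])
  finally show ?thesis .
qed

section \<open>Action of the group on flats and faces\<close>

lemma W_word:
  assumes "w \<in> W"
  obtains as where "as \<in> lists \<Phi>" "rev as \<in> lists \<Phi>" "w = word_map as"
proof -
  obtain as where as: "as \<in> lists \<Phi>" "w = word_map as" using assms by (auto simp: reflection_group_eq)
  moreover have "rev as \<in> lists \<Phi>" using as(1) by auto
  ultimately show thesis using that by blast
qed

lemma W_inverse:
  assumes "w \<in> W"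
  obtains w' where "w' \<in> W" "\<And>v. w' (w v) = v" "\<And>v. w (w' v) = v"
proof -
  obtain as where as: "rev as \<in> lists \<Phi>" "w = word_map as" using W_word[OF assms] .
  show thesis
    by (rule that[OF word_map_in_reflection_group[OF as(1)]]) (simp_all add: as(2))
qed

lemma linear_W: "w \<in> W \<Longrightarrow> linear w" and bij_W: "w \<in> W \<Longrightarrow> bij w"
  using linear_word_map bij_word_map by (metis W_word)+

text \<open>\<open>\<beta>\<close> is the image of \<open>\<alpha>\<close> under the inverse of
  \<open>w\<close>, which is also its adjoint. Sign conditions at \<open>w v\<close> thus become
  sign conditions at \<open>v\<close>.\<close>

lemma W_root:
  assumes "w \<in> W" "\<alpha> \<in> \<Phi>"
  obtains \<beta> where "\<beta> \<in> \<Phi>" "\<And>v. \<alpha> \<bullet> w v = \<beta> \<bullet> v"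
proof -
  obtain as where as: "rev as \<in> lists \<Phi>" "w = word_map as" using W_word[OF assms(1)] .
  have "word_map (rev as) \<alpha> \<in> \<Phi>" using word_map_roots[OF as(1)] assms(2) by blast
  then show thesis by (rule that) (metis as(2) inner_commute inner_word_map_left rev_rev_ident)
qed

lemma face_W:
  assumes w: "w \<in> W" and eq: "face u = face v"
  shows "face (w u) = face (w v)"
  unfolding sign_vector_eq_iff
proof
  fix \<alpha> assume "\<alpha> \<in> \<Phi>"
  then obtain \<beta> where "\<beta> \<in> \<Phi>" "\<And>v. \<alpha> \<bullet> w v = \<beta> \<bullet> v" using W_root[OF w] by blast
  then show "sgn (\<alpha> \<bullet> w u) = sgn (\<alpha> \<bullet> w v)" using eq by (simp add: sign_vector_eq_iff)
qed

lemma W_image_flat: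
  assumes w: "w \<in> W" and X: "X \<in> L"
  shows "w ` X \<in> L"
proof -
  obtain S where S: "S \<subseteq> \<Phi>" "X = {u. \<forall>\<alpha>\<in>S. \<alpha> \<bullet> u = 0}" using X by (auto simp: mem_L_iff)
  obtain as where as: "as \<in> lists \<Phi>" "w = word_map as" using W_word[OF w] .
  have "w ` S \<subseteq> \<Phi>" using S(1) word_map_roots[OF as(1)] as(2) by blast
  moreover have "w ` X = {u. \<forall>\<alpha>\<in>w ` S. \<alpha> \<bullet> u = 0}"
  proof (intro subset_antisym subsetI)
    fix u assume "u \<in> {u. \<forall>\<alpha>\<in>w ` S. \<alpha> \<bullet> u = 0}"
    then have "word_map (rev as) u \<in> X" by (simp add: S(2) as(2) inner_word_map_left)
    then show "u \<in> w ` X" by (rule rev_image_eqI) (simp add: as(2))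
  qed (auto simp: S(2) as(2) inner_word_map)
  ultimately show ?thesis unfolding mem_L_iff by blast
qed

lemma W_permutes_flats:
  assumes "w \<in> W"
  shows "(`) w ` L = L"
proof (intro subset_antisym subsetI)
  fix X assume X: "X \<in> L"
  obtain w' where w': "w' \<in> W" "\<And>v. w (w' v) = v" using W_inverse[OF assms] by metis
  have "w ` w' ` X = X" by (simp add: image_image w'(2))
  then show "X \<in> (`) w ` L" using W_image_flat[OF w'(1) X] by (metis imageI)
qed (auto intro: W_image_flat[OF assms])

lemma segment_char_poly_W:
  assumes "w \<in> W"
  shows "segment_char_poly L (w ` X) = segment_char_poly L X"
proof -
  have inj: "inj w" using bij_W[OF assms] by (rule bij_is_inj)
  have "segment L (w ` X) = (`) w ` segment L X"
  proof (intro subset_antisym subsetI)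
    fix Y assume Y: "Y \<in> segment L (w ` X)"
    then have "Y \<in> (`) w ` L" by (simp add: W_permutes_flats[OF assms] segment_def)
    then obtain Z where "Z \<in> L" "Y = w ` Z" by blast
    then show "Y \<in> (`) w ` segment L X"
      using Y inj_image_subset_iff[OF inj] by (auto simp: segment_def)
  qed (use W_image_flat[OF assms] in \<open>auto simp: segment_def\<close>)
  moreover have "inj_on ((`) w) (segment L X)"
    using inj_image_eq_iff[OF inj] by (auto simp: inj_on_def)
  ultimately show ?thesis
    by (simp add: segment_char_poly_def sum.reindex mobius_image[OF inj W_permutes_flats[OF assms]]
        dim_linear_inj_image[OF linear_W[OF assms] inj])
qed

lemma supp_face_W:
  assumes "w \<in> W"
  shows "supp (face (w v)) = w ` supp (face v)"
proof -
  have sub: "w ` supp (face v) \<subseteq> supp (face (w v))" if "w \<in> W" for w v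
  proof (clarsimp simp: mem_sign_support_sign_vector)
    fix u \<alpha> assume "\<forall>\<alpha>\<in>\<Phi>. \<alpha> \<bullet> v = 0 \<longrightarrow> \<alpha> \<bullet> u = 0" "\<alpha> \<in> \<Phi>" "\<alpha> \<bullet> w v = 0"
    then show "\<alpha> \<bullet> w u = 0" using W_root[OF \<open>w \<in> W\<close>] by metis
  qed
  obtain w' where w': "w' \<in> W" "\<And>v. w' (w v) = v" "\<And>v. w (w' v) = v" using W_inverse[OF assms] by metis
  have "w' ` supp (face (w v)) \<subseteq> supp (face v)" using sub[OF w'(1), of "w v"] w'(2) by simp
  then have "w ` w' ` supp (face (w v)) \<subseteq> w ` supp (face v)" by (rule image_mono)
  then have "supp (face (w v)) \<subseteq> w ` supp (face v)" by (simp add: image_image w'(3))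
  then show ?thesis using sub[OF assms] by blast
qed

lemma flat_term_W: "w \<in> W \<Longrightarrow> flat_term (supp (face (w v))) = flat_term (supp (face v))"
  by (simp add: flat_term_def supp_face_W segment_char_poly_W
      dim_linear_inj_image[OF linear_W bij_is_inj[OF bij_W]])

section \<open>Faces of the fundamental chamber and their types\<close>

lemma chamber_stabilizer:
  assumes "w \<in> W" "x \<in> C" "w x \<in> C"
  shows "w \<in> reflection_group {\<beta> \<in> \<Delta>. \<beta> \<bullet> x = 0}"
proof -
  obtain as where as: "as \<in> lists \<Delta>" "w = word_map as"
    using assms(1) unfolding W_eq by (auto simp: reflection_group_eq)
  show ?thesis using chamber_stabilizer_word[OF as(1) assms(2)] assms(3) as(2) by simp
qed

text \<open>A representative of the relative interior of the chamber's face on the walls of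
  \<open>K\<close>; the value 1 stands for any positive number.\<close>

definition wall_point :: "'a set \<Rightarrow> 'a" where
  "wall_point K = (SOME v. \<forall>\<beta>\<in>\<Delta>. \<beta> \<bullet> v = (if \<beta> \<in> K then 0 else 1))"

lemma inner_wall_point: "\<beta> \<in> \<Delta> \<Longrightarrow> \<beta> \<bullet> wall_point K = (if \<beta> \<in> K then 0 else 1)"
proof -
  have "\<forall>\<beta>\<in>\<Delta>. \<beta> \<bullet> wall_point K = (if \<beta> \<in> K then 0 else 1)"
    unfolding wall_point_def by (rule someI_ex[OF base_dual])
  then show "\<beta> \<in> \<Delta> \<Longrightarrow> \<beta> \<bullet> wall_point K = (if \<beta> \<in> K then 0 else 1)" by (rule bspec)
qed

lemma wall_point_chamber: "wall_point K \<in> C"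
  by (simp add: closed_chamber_def inner_wall_point)

lemma walls_of_wall_point: "K \<subseteq> \<Delta> \<Longrightarrow> {\<beta> \<in> \<Delta>. \<beta> \<bullet> wall_point K = 0} = K"
  by (auto simp: inner_wall_point split: if_splits)

lemma face_eq_chamber:
  assumes x: "x \<in> C" and y: "face x = face y"
  shows "y \<in> C"
proof -
  have "0 \<le> \<beta> \<bullet> y" if \<beta>: "\<beta> \<in> \<Delta>" for \<beta>
  proof -
    have "sgn (\<beta> \<bullet> x) = sgn (\<beta> \<bullet> y)"
      using y \<beta> base_subset unfolding sign_vector_eq_iff by blast
    moreover have "0 \<le> \<beta> \<bullet> x" using x \<beta> by (simp add: closed_chamber_def)
    ultimately show ?thesis by (simp add: sgn_if split: if_splits)
  qed
  then show ?thesis by (simp add: closed_chamber_def)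
qed

lemma cone_sgn_chamber:
  assumes "v \<in> nonneg_cone \<Delta>" "x \<in> C" "y \<in> C"
    and "\<And>\<beta>. \<beta> \<in> \<Delta> \<Longrightarrow> \<beta> \<bullet> x = 0 \<longleftrightarrow> \<beta> \<bullet> y = 0"
  shows "sgn (v \<bullet> x) = sgn (v \<bullet> y)"
proof -
  have "v \<bullet> x \<ge> 0" "v \<bullet> y \<ge> 0" using cone_inner_chamber assms by blast+
  moreover have "v \<bullet> x = 0 \<longleftrightarrow> v \<bullet> y = 0"
    using cone_inner_eq_0[OF finite_base assms(1)] assms by metis
  ultimately show ?thesis by (simp add: sgn_if)
qed

text \<open>On the chamber a simple root has sign 0 or 1, so its zeros determine its signs. Every
  root is up to sign a nonnegative combination of simple roots, which carries this over to all of
  \<open>\<Phi>\<close>.\<close>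

lemma face_chamber_eqI:
  assumes x: "x \<in> C" and y: "y \<in> C" and eq: "\<And>\<beta>. \<beta> \<in> \<Delta> \<Longrightarrow> \<beta> \<bullet> x = 0 \<longleftrightarrow> \<beta> \<bullet> y = 0"
  shows "face x = face y"
  unfolding sign_vector_eq_iff
proof
  fix \<alpha> assume "\<alpha> \<in> \<Phi>"
  then show "sgn (\<alpha> \<bullet> x) = sgn (\<alpha> \<bullet> y)"
  proof (cases rule: root_cases)
    case 1
    then show ?thesis by (rule cone_sgn_chamber[OF _ x y eq])
  next
    case 2
    then have "sgn (- \<alpha> \<bullet> x) = sgn (- \<alpha> \<bullet> y)" by (rule cone_sgn_chamber[OF _ x y eq])
    then show ?thesis by (simp add: sgn_minus)
  qed
qed

text \<open>The simple roots outside \<open>K\<close> are positive at the point, so a root vanishing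
  there is a combination of \<open>K\<close> and imposes no condition beyond orthogonality to
  \<open>K\<close>.\<close>

lemma supp_wall_point:
  assumes "K \<subseteq> \<Delta>"
  shows "supp (face (wall_point K)) = Fix (reflection_group K)"
  unfolding Fix_reflection_group
proof (intro subset_antisym subsetI CollectI ballI)
  fix u \<beta> assume "u \<in> supp (face (wall_point K))" "\<beta> \<in> K"
  moreover have "\<beta> \<in> \<Phi>" "\<beta> \<bullet> wall_point K = 0"
    using \<open>\<beta> \<in> K\<close> assms base_subset by (auto simp: subset_iff inner_wall_point)
  ultimately show "\<beta> \<bullet> u = 0" by (simp add: mem_sign_support_sign_vector)
next
  fix u assume u: "u \<in> {v. \<forall>\<alpha>\<in>K. \<alpha> \<bullet> v = 0}"
  have cone: "v \<bullet> u = 0" if "v \<in> nonneg_cone \<Delta>" "v \<bullet> wall_point K = 0" for v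
    by (rule cone_inner_eq_0[OF finite_base that(1) wall_point_chamber _ that(2)])
      (use u in \<open>auto simp: inner_wall_point split: if_splits\<close>)
  have "\<alpha> \<bullet> u = 0" if "\<alpha> \<in> \<Phi>" "\<alpha> \<bullet> wall_point K = 0" for \<alpha>
    using that(1)
  proof (cases rule: root_cases)
    case 1
    then show ?thesis using cone that(2) by blast
  next
    case 2
    then show ?thesis using cone[of "- \<alpha>"] that(2) by simp
  qed
  then show "u \<in> supp (face (wall_point K))" by (simp add: mem_sign_support_sign_vector)
qed

lemma dim_UNIV: "dim (UNIV :: 'a set) = card \<Delta>"
  using dim_span_eq_card_independent[OF independent_base] by (simp add: base_spans)

lemma dim_Fix:
  assumes "K \<subseteq> \<Delta>"
  shows "dim (Fix (reflection_group K)) + card K = card \<Delta>"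
proof -
  have "finite K" using assms finite_base finite_subset by blast
  then show ?thesis using assms unfolding Fix_reflection_group
  proof (induction K rule: finite_induct)
    case empty
    then show ?case by (simp add: dim_UNIV)
  next
    case (insert \<beta> K)
    let ?S = "{v. \<forall>\<alpha>\<in>K. \<alpha> \<bullet> v = 0}"
    have S: "subspace ?S" by (auto simp: subspace_def inner_add_right)
    \<comment> \<open>This point of \<open>?S\<close> lies off the hyperplane of
      \<open>\<beta>\<close>, so the dimension drops by exactly one.\<close>
    have "wall_point K \<in> ?S" using insert.prems by (auto simp: inner_wall_point)
    moreover have "\<beta> \<bullet> wall_point K \<noteq> 0" using insert by (simp add: inner_wall_point)
    ultimately have "dim ?S = Suc (dim (?S \<inter> {v. \<beta> \<bullet> v = 0}))"
      by (rule dim_Int_hyperplane[OF finite_roots span_roots S])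
    moreover have "?S \<inter> {v. \<beta> \<bullet> v = 0} = {v. \<forall>\<alpha>\<in>insert \<beta> K. \<alpha> \<bullet> v = 0}" by auto
    ultimately show ?case using insert by simp
  qed
qed

definition faces_of_type :: "'a set \<Rightarrow> ('a \<Rightarrow> real) set" where
  "faces_of_type K = (\<lambda>w. face (w (wall_point K))) ` W"

text \<open>Membership in the chamber can be read off from a face, so the result on points of the
  chamber passes to faces. The first conclusion gives the stabilizer for counting an orbit, the
  second separates orbits of different types.\<close>

lemma face_wall_point_coset:
  assumes K: "K \<subseteq> \<Delta>" and w: "w \<in> W" and eq: "face (w (wall_point K)) = face y" and y: "y \<in> C"
  shows "w \<in> reflection_group K" "face y = face (wall_point K)"
proof -
  have "w (wall_point K) \<in> C" using face_eq_chamber[OF y] eq by simp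
  then show wK: "w \<in> reflection_group K"
    using chamber_stabilizer[OF w wall_point_chamber[of K]] walls_of_wall_point[OF K] by simp
  have "\<forall>\<alpha>\<in>K. \<alpha> \<bullet> wall_point K = 0" using K by (auto simp: inner_wall_point)
  then show "face y = face (wall_point K)" using reflection_group_fixes[OF wK] eq by simp
qed

text \<open>Orbit and stabilizer: the fibres of \<open>?f\<close> are the left cosets of
  \<open>reflection_group K\<close>.\<close>

lemma card_faces_of_type:
  assumes K: "K \<subseteq> \<Delta>"
  shows "card (faces_of_type K) * card (reflection_group K) = card W"
proof -
  let ?f = "\<lambda>w. face (w (wall_point K))"
  have fib: "card {u \<in> W. ?f u = \<sigma>} = card (reflection_group K)" if \<sigma>: "\<sigma> \<in> ?f ` W" for \<sigma>
  proof -
    obtain w where w: "w \<in> W" "\<sigma> = ?f w" using \<sigma> by blast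
    obtain w' where w': "w' \<in> W" "\<And>v. w' (w v) = v" "\<And>v. w (w' v) = v"
      using W_inverse[OF w(1)] by metis
    have KW: "reflection_group K \<subseteq> W" using K base_subset by (intro reflection_group_mono) auto
    have fixed: "u (wall_point K) = wall_point K" if "u \<in> reflection_group K" for u
      by (rule reflection_group_fixes[OF that]) (use K in \<open>auto simp: inner_wall_point\<close>)
    have "{u \<in> W. ?f u = \<sigma>} = (\<circ>) w ` reflection_group K"
    proof (intro subset_antisym subsetI)
      fix u assume u: "u \<in> {u \<in> W. ?f u = \<sigma>}"
      then have "face (w' (u (wall_point K))) = face (w' (w (wall_point K)))"
        using face_W[OF w'(1)] w(2) by blast
      then have "face ((w' \<circ> u) (wall_point K)) = face (wall_point K)" by (simp add: w'(2))
      then have "w' \<circ> u \<in> reflection_group K"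
        using face_wall_point_coset(1)[OF K comp_in_reflection_group[OF w'(1)] _ wall_point_chamber] u
        by blast
      moreover have "u = w \<circ> (w' \<circ> u)" by (simp add: fun_eq_iff w'(3))
      ultimately show "u \<in> (\<circ>) w ` reflection_group K" by blast
    next
      fix u assume "u \<in> (\<circ>) w ` reflection_group K"
      then obtain g where g: "g \<in> reflection_group K" "u = w \<circ> g" by blast
      then have "u \<in> W" using KW w(1) comp_in_reflection_group by blast
      moreover have "?f u = \<sigma>" using g(2) fixed[OF g(1)] w(2) by simp
      ultimately show "u \<in> {u \<in> W. ?f u = \<sigma>}" by simp
    qed
    moreover have "inj_on ((\<circ>) w) (reflection_group K)"
      using bij_W[OF w(1)] by (intro inj_onI) (metis bij_is_inj fun.inj_map_strong inj_eq)
    ultimately show ?thesis by (simp add: card_image)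
  qed
  have "card W = (\<Sum>\<sigma>\<in>?f ` W. card {u \<in> W. ?f u = \<sigma>})"
    using sum.image_gen[OF finite_W, of "\<lambda>_. 1::nat" ?f] by simp
  also have "\<dots> = card (faces_of_type K) * card (reflection_group K)"
    using fib by (simp add: faces_of_type_def)
  finally show ?thesis by simp
qed

text \<open>A group element taking one face of the chamber to another fixes it, and the type is
  recovered as the set of simple roots vanishing there.\<close>

lemma disjoint_faces_of_type:
  assumes K: "K \<subseteq> \<Delta>" and K': "K' \<subseteq> \<Delta>" and ne: "faces_of_type K \<inter> faces_of_type K' \<noteq> {}"
  shows "K = K'"
proof -
  obtain w u where wu: "w \<in> W" "u \<in> W" "face (w (wall_point K)) = face (u (wall_point K'))"
    using ne by (auto simp: faces_of_type_def)
  obtain u' where u': "u' \<in> W" "\<And>v. u' (u v) = v" using W_inverse[OF wu(2)] by metis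
  have "face ((u' \<circ> w) (wall_point K)) = face (wall_point K')"
    using face_W[OF u'(1) wu(3)] by (simp add: u'(2))
  then have "face (wall_point K') = face (wall_point K)"
    by (rule face_wall_point_coset(2)[OF K comp_in_reflection_group[OF u'(1) wu(1)] _ wall_point_chamber])
  then have "\<beta> \<bullet> wall_point K' = 0 \<longleftrightarrow> \<beta> \<bullet> wall_point K = 0" if "\<beta> \<in> \<Delta>" for \<beta>
    using that base_subset unfolding sign_vector_eq_iff by (metis sgn_zero_iff subsetD)
  then show ?thesis using walls_of_wall_point[OF K] walls_of_wall_point[OF K'] by blast
qed

lemma faces_by_type: "range face = (\<Union>K\<in>Pow \<Delta>. faces_of_type K)"
proof (intro subset_antisym subsetI)
  fix \<sigma> assume "\<sigma> \<in> range face"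
  then obtain v where v: "\<sigma> = face v" by blast
  obtain w where w: "w \<in> W" "w v \<in> C" using move_to_chamber W_eq by blast
  obtain w' where w': "w' \<in> W" "\<And>v. w' (w v) = v" using W_inverse[OF w(1)] by metis
  let ?K = "{\<beta> \<in> \<Delta>. \<beta> \<bullet> w v = 0}"
  have "face (w v) = face (wall_point ?K)"
    by (rule face_chamber_eqI[OF w(2) wall_point_chamber]) (simp add: inner_wall_point)
  then have "face v = face (w' (wall_point ?K))" using face_W[OF w'(1)] w'(2) by metis
  then have "\<sigma> \<in> faces_of_type ?K"
    unfolding faces_of_type_def v by (intro image_eqI[of _ _ w']) (auto simp: w'(1))
  then show "\<sigma> \<in> (\<Union>K\<in>Pow \<Delta>. faces_of_type K)" by (rule UN_I[rotated]) auto
next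
  fix \<sigma> assume "\<sigma> \<in> (\<Union>K\<in>Pow \<Delta>. faces_of_type K)"
  then obtain K w where "\<sigma> = face (w (wall_point K))" by (force simp: faces_of_type_def)
  then show "\<sigma> \<in> range face" by simp
qed

lemma sum_over_types:
  "(\<Sum>K\<in>Pow \<Delta>. smult (real (card W) / real (card (reflection_group K)))
      (flat_term (Fix (reflection_group K)))) = monom 1 (card \<Delta>)"
proof -
  have "(\<Sum>K\<in>Pow \<Delta>. smult (real (card W) / real (card (reflection_group K)))
      (flat_term (Fix (reflection_group K))))
      = (\<Sum>K\<in>Pow \<Delta>. \<Sum>\<sigma>\<in>faces_of_type K. flat_term (supp \<sigma>))"
  proof (rule sum.cong[OF refl])
    fix K assume "K \<in> Pow \<Delta>"
    then have K: "K \<subseteq> \<Delta>" by simp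
    have "finite (reflection_group K)"
      using finite_W reflection_group_mono K base_subset by (metis finite_subset order_trans)
    then have pos: "card (reflection_group K) \<noteq> 0" using id_in_reflection_group[of K] by auto
    have "(\<Sum>\<sigma>\<in>faces_of_type K. flat_term (supp \<sigma>))
        = (\<Sum>\<sigma>\<in>faces_of_type K. flat_term (Fix (reflection_group K)))"
      by (intro sum.cong refl) (auto simp: faces_of_type_def flat_term_W supp_wall_point[OF K])
    also have "\<dots> = smult (real (card (faces_of_type K))) (flat_term (Fix (reflection_group K)))"
      by (simp add: of_nat_poly)
    also have "real (card (faces_of_type K)) = real (card W) / real (card (reflection_group K))"
      using pos by (simp add: card_faces_of_type[OF K, symmetric])
    finally show "smult (real (card W) / real (card (reflection_group K)))
        (flat_term (Fix (reflection_group K))) = (\<Sum>\<sigma>\<in>faces_of_type K. flat_term (supp \<sigma>))" by simp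
  qed
  also have "\<dots> = (\<Sum>\<sigma>\<in>range face. flat_term (supp \<sigma>))"
    unfolding faces_by_type
  proof (rule sum.UNION_disjoint[symmetric])
    show "\<forall>K\<in>Pow \<Delta>. finite (faces_of_type K)" by (simp add: faces_of_type_def finite_W)
    show "\<forall>K\<in>Pow \<Delta>. \<forall>K'\<in>Pow \<Delta>. K \<noteq> K' \<longrightarrow> faces_of_type K \<inter> faces_of_type K' = {}"
      by (intro ballI impI) (metis PowD disjoint_faces_of_type)
  qed (simp add: finite_base)
  finally show ?thesis by (simp add: sum_flat_term dim_UNIV)
qed

end

theorem theorem2:
  fixes \<Phi> \<Delta> :: "'a::real_inner set" and n :: nat
  assumes "root_system \<Phi>"
    and "root_base \<Phi> \<Delta>"
    and "card \<Delta> = n"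
  shows "(\<Sum>K\<in>Pow \<Delta>.
            smult ((- 1) ^ (n - card K)
                   * (real (card (reflection_group \<Phi>)) / real (card (reflection_group K)))
                   / poly (segment_char_poly (intersection_lattice \<Phi>) (Fix (reflection_group K))) (- 1))
              (segment_char_poly (intersection_lattice \<Phi>) (Fix (reflection_group K))))
         = monom 1 n"
proof -
  interpret based_root_system \<Phi> \<Delta> by unfold_locales fact+
  \<comment> \<open>The exponent of the sign is the dimension of the flat, so the sign is the one
    built into \<open>flat_term\<close>.\<close>
  have "n - card K = dim (Fix (reflection_group K))" if "K \<in> Pow \<Delta>" for K
    using dim_Fix[of K] that assms(3) by auto
  then show ?thesis
    unfolding sum_over_types[unfolded assms(3), symmetric]
    by (intro sum.cong refl) (simp add: flat_term_def mult.commute)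
qed

end
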